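(* Let $(X,p)$ be a smooth analytic germ of dimension $d$ in $\mathbb{C}^n$ (with $p\in X$), with $d<n$. Then for $1\le k\le n$, as ideals of $\mathcal{O}_{\mathbb{C}^n,p}$, $$I_k(\mathrm{Der}(-\log X)_p)=\begin{cases}(I(X))^{k-d} & \text{if } k>d,\\ (1) & \text{otherwise.}\end{cases}$$
   Context: $\mathcal{O}_{\mathbb{C}^n,p}$ is the ring of germs at $p$ of holomorphic functions and $\mathrm{Der}_{\mathbb{C}^n,p}$ the module of germs at $p$ of holomorphic vector fields. For an analytic germ $(X,p)$ (always reduced), $I(X)\subseteq\mathcal{O}_{\mathbb{C}^n,p}$ is the ideal of germs vanishing on $X$, and $\mathrm{Der}(-\log X)_p=\{\eta\in \mathrm{Der}_{\mathbb{C}^n,p}:\eta(I(X))\subseteq I(X)\}$. For a submodule $L\subseteq\mathrm{Der}_{\mathbb{C}^n,p}$ generated by $\eta_1,\ldots,\eta_m$, write $\eta_j=\sum_{i=1}^n a_{ij}\frac{\partial}{\partial z_i}$ in holomorphic coordinates; $I_k(L)$ ($1\le k\le n$) is the ideal generated by the $k\times k$ minors of the $n\times m$ matrix $(a_{ij})$. It is independent of choices, being the $(n-k)$th Fitting ideal of $\mathrm{Der}_{\mathbb{C}^n,p}/L$. *)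

theory Defs
  imports "HOL-Analysis.Analysis" "HOL-Algebra.Ideal_Product" "HOL-Algebra.QuotRing" "HOL-Algebra.Module"
begin

section \<open>Holomorphic functions of several variables\<close>

text \<open>
  Points of $\mathbb{C}^n$ have type \<open>complex ^ 'n\<close> with \<open>n = CARD('n)\<close>.
  The library derivative is the real Frechet derivative; holomorphy requires it to be complex linear.
\<close>

definition holo_on :: "(complex ^ 'n) set \<Rightarrow> (complex ^ 'n \<Rightarrow> complex) \<Rightarrow> bool" where
  "holo_on U f \<longleftrightarrow>
     (\<forall>z\<in>U. \<exists>D. (f has_derivative D) (at z) \<and> (\<forall>c v. D (c *s v) = c * D v))"

definition holo_map_on :: "(complex ^ 'n) set \<Rightarrow> (complex ^ 'n \<Rightarrow> complex ^ 'n) \<Rightarrow> bool" where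
  "holo_map_on U F \<longleftrightarrow> (\<forall>i. holo_on U (\<lambda>z. F z $ i))"

definition holo_near :: "complex ^ 'n \<Rightarrow> (complex ^ 'n \<Rightarrow> complex) \<Rightarrow> bool" where
  "holo_near p f \<longleftrightarrow> (\<exists>U. open U \<and> p \<in> U \<and> holo_on U f)"


section \<open>The local ring of germs of holomorphic functions at \<open>p\<close>\<close>

type_synonym 'n germ = "(complex ^ 'n \<Rightarrow> complex) set"

definition holo_ring :: "complex ^ 'n \<Rightarrow> (complex ^ 'n \<Rightarrow> complex) ring" where
  "holo_ring p =
     \<lparr>carrier = {f. holo_near p f},
      mult = (\<lambda>f g z. f z * g z), one = (\<lambda>z. 1),
      zero = (\<lambda>z. 0), add = (\<lambda>f g z. f z + g z)\<rparr>"

definition null_near :: "complex ^ 'n \<Rightarrow> (complex ^ 'n \<Rightarrow> complex) set" where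
  "null_near p = {f. holo_near p f \<and> (\<forall>\<^sub>F z in nhds p. f z = 0)}"

text \<open>
  Two functions holomorphic near \<open>p\<close> have the same germ iff their difference lies in
  \<open>null_near p\<close>, so germs are the cosets of that ideal.
\<close>

definition germ_ring :: "complex ^ 'n \<Rightarrow> 'n germ ring" where
  "germ_ring p = holo_ring p Quot null_near p"

definition germ :: "complex ^ 'n \<Rightarrow> (complex ^ 'n \<Rightarrow> complex) \<Rightarrow> 'n germ" where
  "germ p f = null_near p +>\<^bsub>holo_ring p\<^esub> f"

definition germ_pderiv :: "complex ^ 'n \<Rightarrow> 'n \<Rightarrow> 'n germ \<Rightarrow> 'n germ" where
  "germ_pderiv p i G =
     germ p (\<lambda>z. deriv (\<lambda>t. (SOME f. f \<in> G) (z + axis i t)) 0)"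


section \<open>Analytic germs and their ideals\<close>

text \<open>
  A set germ \<open>(X, p)\<close> is given by a representative \<open>X\<close>; everything below only depends on
  \<open>X\<close> near \<open>p\<close>. The germ is smooth of dimension \<open>d\<close> if it is the germ of a \<open>d\<close>-dimensional
  complex submanifold: some biholomorphism of a neighbourhood of \<open>p\<close> onto an open set
  maps \<open>X\<close> to a coordinate subspace of dimension \<open>d\<close> (with free coordinates \<open>S\<close>).
  In particular \<open>X\<close> is analytic near \<open>p\<close>.
\<close>

definition smooth_analytic_germ :: "(complex ^ 'n) set \<Rightarrow> complex ^ 'n \<Rightarrow> nat \<Rightarrow> bool" where
  "smooth_analytic_germ X p d \<longleftrightarrow>
     p \<in> X \<and>
     (\<exists>U V \<phi> \<psi> S.
        open U \<and> p \<in> U \<and> open V \<and>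
        holo_map_on U \<phi> \<and> holo_map_on V \<psi> \<and>
        \<phi> ` U = V \<and> \<psi> ` V = U \<and> (\<forall>z\<in>U. \<psi> (\<phi> z) = z) \<and> (\<forall>w\<in>V. \<phi> (\<psi> w) = w) \<and>
        card S = d \<and> \<phi> ` (X \<inter> U) = {w \<in> V. \<forall>i. i \<notin> S \<longrightarrow> w $ i = 0})"

definition vanishing_ideal :: "complex ^ 'n \<Rightarrow> (complex ^ 'n) set \<Rightarrow> 'n germ set" where
  "vanishing_ideal p X =
     {germ p f | f. holo_near p f \<and> (\<forall>\<^sub>F z in nhds p. z \<in> X \<longrightarrow> f z = 0)}"


section \<open>Germs of holomorphic vector fields\<close>

text \<open>
  The vector field germ \<open>\<Sum>i. a i \<partial>/\<partial>z_i\<close> is represented by its vector of coefficient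
  germs \<open>\<chi> i. a i\<close>. The fields \<open>mult\<close> and \<open>one\<close> of the record type \<open>module\<close> play no role.
\<close>

definition der_module :: "complex ^ 'n \<Rightarrow> ('n germ, 'n germ ^ 'n) module" where
  "der_module p =
     \<lparr>carrier = {\<eta>. \<forall>i. \<eta> $ i \<in> carrier (germ_ring p)},
      mult = undefined, one = undefined,
      zero = (\<chi> i. \<zero>\<^bsub>germ_ring p\<^esub>),
      add = (\<lambda>\<eta> \<theta>. \<chi> i. \<eta> $ i \<oplus>\<^bsub>germ_ring p\<^esub> \<theta> $ i),
      smult = (\<lambda>a \<eta>. \<chi> i. a \<otimes>\<^bsub>germ_ring p\<^esub> \<eta> $ i)\<rparr>"

definition der_apply :: "complex ^ 'n \<Rightarrow> 'n germ ^ 'n \<Rightarrow> 'n germ \<Rightarrow> 'n germ" where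
  "der_apply p \<eta> G =
     (\<Oplus>\<^bsub>germ_ring p\<^esub> i\<in>UNIV. \<eta> $ i \<otimes>\<^bsub>germ_ring p\<^esub> germ_pderiv p i G)"

definition der_log :: "complex ^ 'n \<Rightarrow> (complex ^ 'n) set \<Rightarrow> ('n germ ^ 'n) set" where
  "der_log p X =
     {\<eta> \<in> carrier (der_module p).
        \<forall>G \<in> vanishing_ideal p X. der_apply p \<eta> G \<in> vanishing_ideal p X}"


section \<open>Ideals of minors\<close>

definition ring_det :: "('a, 'b) ring_scheme \<Rightarrow> nat \<Rightarrow> (nat \<Rightarrow> nat \<Rightarrow> 'a) \<Rightarrow> 'a" where
  "ring_det R k A =
     (\<Oplus>\<^bsub>R\<^esub> \<sigma>\<in>{\<sigma>. \<sigma> permutes {..<k}}.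
        (if evenperm \<sigma> then \<one>\<^bsub>R\<^esub> else \<ominus>\<^bsub>R\<^esub> \<one>\<^bsub>R\<^esub>) \<otimes>\<^bsub>R\<^esub> (\<Otimes>\<^bsub>R\<^esub> s\<in>{..<k}. A s (\<sigma> s)))"

definition generates ::
  "('a, 'c) ring_scheme \<Rightarrow> ('a, 'b, 'd) module_scheme \<Rightarrow> nat \<Rightarrow> (nat \<Rightarrow> 'b) \<Rightarrow> 'b set \<Rightarrow> bool" where
  "generates R M m \<eta> L \<longleftrightarrow>
     (\<forall>j<m. \<eta> j \<in> carrier M) \<and>
     L = {(\<Oplus>\<^bsub>M\<^esub> j\<in>{..<m}. c j \<odot>\<^bsub>M\<^esub> \<eta> j) | c. \<forall>j<m. c j \<in> carrier R}"

text \<open>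
  The ideal generated by the \<open>k \<times> k\<close> minors of the matrix with columns \<open>\<eta> 0, \<dots>, \<eta> (m - 1)\<close>.
  Rows (indexed by the unordered type \<open>'n\<close>) and columns are selected by injective maps;
  reordering the selection changes a minor only by a sign.
\<close>

definition minors_ideal :: "complex ^ 'n \<Rightarrow> nat \<Rightarrow> nat \<Rightarrow> (nat \<Rightarrow> 'n germ ^ 'n) \<Rightarrow> 'n germ set" where
  "minors_ideal p k m \<eta> =
     Idl\<^bsub>germ_ring p\<^esub>
       {ring_det (germ_ring p) k (\<lambda>s t. \<eta> (c t) $ r s) | r c.
          inj_on r {..<k} \<and> inj_on c {..<k} \<and> c ` {..<k} \<subseteq> {..<m}}"

text \<open>
  The ideal \<open>I\<^sub>k(L)\<close>, computed from any finite generating family of \<open>L\<close>. The description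
  operator has a meaningful value exactly because a finitely generated \<open>L\<close> has a generating
  family and the ideal of minors does not depend on its choice.
\<close>

definition I_minors :: "complex ^ 'n \<Rightarrow> nat \<Rightarrow> ('n germ ^ 'n) set \<Rightarrow> 'n germ set" where
  "I_minors p k L =
     (THE J. \<exists>m \<eta>. generates (germ_ring p) (der_module p) m \<eta> L \<and> J = minors_ideal p k m \<eta>)"

end

theory Submission
  imports Defs "HOL-Complex_Analysis.Cauchy_Integral_Formula"
begin

text \<open>
  Let \<open>\<phi>\<close> be a biholomorphism that maps \<open>X\<close> to the coordinate subspace with free coordinates \<open>S\<close>, let
  \<open>\<psi>\<close> be its inverse, \<open>J\<close> the Jacobian matrix of \<open>\<phi>\<close> over the ring of germs at \<open>p\<close>, and
  \<open>I = I(X)\<close>. The components of \<open>J \<eta>\<close> are the coefficients of the vector field \<open>\<eta>\<close> in the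
  coordinates \<open>\<phi>\<close>. A field is logarithmic exactly if \<open>(J \<eta>)\<^sub>i \<in> I\<close> for all \<open>i \<notin> S\<close>
  (\<open>der_log_eq\<close>). Indeed, \<open>(J \<eta>)\<^sub>i\<close> is \<open>\<eta>\<close> applied to \<open>\<phi>\<^sub>i\<close>, a germ in \<open>I\<close>. Conversely, for
  \<open>f \<in> I\<close> the chain rule for \<open>f = (f \<circ> \<psi>) \<circ> \<phi>\<close> writes \<open>\<eta>(f)\<close> as the sum of the
  \<open>(J \<eta>)\<^sub>i\<close> times \<open>\<partial>\<^sub>i (f \<circ> \<psi>)\<close> at \<open>\<phi>\<close>, and for \<open>i \<in> S\<close> the latter vanishes on \<open>X\<close> because
  \<open>f \<circ> \<psi>\<close> is zero along the subspace.

  The rest is linear algebra over a commutative ring (\<open>ideal_of_minors_log_submodule\<close>). By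
  multilinearity, multiplication with the invertible matrix \<open>J\<close> does not change the ideal
  of minors (\<open>ring_det_rows_in_span\<close>), so minors of the vectors \<open>\<theta> = J \<eta>\<close> may be considered.
  A minor uses \<open>k\<close> distinct rows, at least \<open>k - d\<close> of them outside \<open>S\<close>, so every term of its
  expansion lies in \<open>I\<close> to the power \<open>k - d\<close>. Conversely, a product of \<open>k - d\<close> elements of \<open>I\<close> is a
  diagonal minor: put its factors in rows outside \<open>S\<close> and \<open>1\<close> in the remaining rows, which can be
  chosen inside \<open>S\<close>.

  The ideal \<open>I\<^sub>k(L)\<close> is read off from a finite generating family of \<open>L\<close>. All such families give the
  ideal of all minors of vectors of \<open>L\<close>, again by multilinearity
  (\<open>ideal_of_minors_generating_family\<close>), but one has to exist. It does because the coordinates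
  \<open>\<phi>\<^sub>i\<close>, \<open>i \<notin> S\<close>, generate \<open>I\<close> (\<open>vanishing_ideal_generated\<close>). This is Hadamard's lemma
  \<open>hadamard_division\<close>, whose quotients are integrals of partial derivatives; their holomorphy rests
  on the fact that a partial derivative of a holomorphic function is holomorphic (\<open>holo_on_pd\<close>).
\<close>

section \<open>Determinants over a commutative ring\<close>

context cring
begin

lemma finsum_swap:
  assumes "finite A" "finite B" "\<And>i j. i \<in> A \<Longrightarrow> j \<in> B \<Longrightarrow> f i j \<in> carrier R"
  shows "(\<Oplus>i\<in>A. \<Oplus>j\<in>B. f i j) = (\<Oplus>j\<in>B. \<Oplus>i\<in>A. f i j)"
  using assms(1,3)
proof (induction A rule: finite_induct)
  case empty
  then show ?case by simp
next
  case (insert a A)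
  have "(\<Oplus>j\<in>B. \<Oplus>i\<in>insert a A. f i j) = (\<Oplus>j\<in>B. f a j \<oplus> (\<Oplus>i\<in>A. f i j))"
    using insert by (intro finsum_cong') (auto simp: Pi_iff intro!: finsum_closed)
  also have "\<dots> = (\<Oplus>j\<in>B. f a j) \<oplus> (\<Oplus>j\<in>B. \<Oplus>i\<in>A. f i j)"
    using insert by (intro finsum_addf) (auto intro!: finsum_closed)
  also have "(\<Oplus>j\<in>B. \<Oplus>i\<in>A. f i j) = (\<Oplus>i\<in>A. \<Oplus>j\<in>B. f i j)"
    using insert by simp
  finally show ?case
    using insert by (simp add: Pi_iff finsum_closed)
qed

lemma finsum_single:
  assumes "finite A" "a \<in> A" "f \<in> A \<rightarrow> carrier R" "\<And>i. i \<in> A \<Longrightarrow> i \<noteq> a \<Longrightarrow> f i = \<zero>"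
  shows "(\<Oplus>i\<in>A. f i) = f a"
proof -
  have "(\<Oplus>i\<in>A. f i) = (\<Oplus>i\<in>A. if a = i then f i else \<zero>)"
    using assms by (intro finsum_cong') auto
  also have "\<dots> = f a"
    using assms by (intro finsum_singleton) auto
  finally show ?thesis .
qed

lemma ideal_finsum_closed:
  assumes "ideal P R" "\<And>i. i \<in> A \<Longrightarrow> f i \<in> P"
  shows "(\<Oplus>i\<in>A. f i) \<in> P"
proof -
  interpret P: ideal P R by (rule assms(1))
  show ?thesis
    using assms(2)
  proof (induction A rule: infinite_finite_induct)
    case (insert a A)
    then have "f a \<in> carrier R" "f \<in> A \<rightarrow> carrier R" using P.Icarr by auto
    then show ?case using insert by (simp add: P.a_closed)
  qed (simp_all add: P.zero_closed)
qed

lemma ring_det_cong: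
  assumes "\<And>s t. s < k \<Longrightarrow> t < k \<Longrightarrow> A s t = B s t"
    and "\<And>s t. s < k \<Longrightarrow> t < k \<Longrightarrow> B s t \<in> carrier R"
  shows "ring_det R k A = ring_det R k B"
  unfolding ring_det_def
proof (intro finsum_cong' refl)
  fix \<sigma> assume "\<sigma> \<in> {\<sigma>. \<sigma> permutes {..<k}}"
  then have *: "\<sigma> s < k" if "s < k" for s
    using that permutes_in_image[of \<sigma> "{..<k}" s] by auto
  have "(\<Otimes>s\<in>{..<k}. A s (\<sigma> s)) = (\<Otimes>s\<in>{..<k}. B s (\<sigma> s))"
    using assms * by (intro finprod_cong') auto
  then show "(if evenperm \<sigma> then \<one> else \<ominus> \<one>) \<otimes> (\<Otimes>s\<in>{..<k}. A s (\<sigma> s)) =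
        (if evenperm \<sigma> then \<one> else \<ominus> \<one>) \<otimes> (\<Otimes>s\<in>{..<k}. B s (\<sigma> s))"
    by simp
next
  show "(\<lambda>\<sigma>. (if evenperm \<sigma> then \<one> else \<ominus> \<one>) \<otimes> (\<Otimes>s\<in>{..<k}. B s (\<sigma> s)))
      \<in> {\<sigma>. \<sigma> permutes {..<k}} \<rightarrow> carrier R"
    using assms(2) permutes_in_image[of _ "{..<k}"] by (auto intro!: finprod_closed m_closed)
qed

lemma ring_det_closed:
  assumes "\<And>s t. s < k \<Longrightarrow> t < k \<Longrightarrow> A s t \<in> carrier R"
  shows "ring_det R k A \<in> carrier R"
  unfolding ring_det_def
  using assms permutes_in_image[of _ "{..<k}"]
  by (auto intro!: finsum_closed finprod_closed m_closed)

text \<open>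
  Every term of the determinant contains exactly one entry of row \<open>s\<^sub>0\<close>, so the determinant is a
  linear form in that row, with coefficients that do not depend on it.
\<close>

lemma ring_det_linear_form_in_row:
  assumes "s\<^sub>0 < k" and A: "\<And>s t. s < k \<Longrightarrow> t < k \<Longrightarrow> s \<noteq> s\<^sub>0 \<Longrightarrow> A s t \<in> carrier R"
  shows "\<exists>w. (\<forall>\<sigma>. \<sigma> permutes {..<k} \<longrightarrow> w \<sigma> \<in> carrier R) \<and>
    (\<forall>v. (\<forall>t<k. v t \<in> carrier R) \<longrightarrow>
      ring_det R k (A(s\<^sub>0 := v)) = (\<Oplus>\<sigma>\<in>{\<sigma>. \<sigma> permutes {..<k}}. v (\<sigma> s\<^sub>0) \<otimes> w \<sigma>))"
proof -
  define w where "w \<sigma> = (if evenperm \<sigma> then \<one> else \<ominus> \<one>) \<otimes> (\<Otimes>s\<in>{..<k} - {s\<^sub>0}. A s (\<sigma> s))" for \<sigma>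
  have lt: "\<sigma> s < k" if "\<sigma> permutes {..<k}" "s < k" for s and \<sigma> :: "nat \<Rightarrow> nat"
    using that permutes_in_image[of \<sigma> "{..<k}" s] by auto
  have P: "(\<Otimes>s\<in>{..<k} - {s\<^sub>0}. A s (\<sigma> s)) \<in> carrier R" if "\<sigma> permutes {..<k}" for \<sigma>
    using that A lt by (intro finprod_closed) auto
  have w: "w \<sigma> \<in> carrier R" if "\<sigma> permutes {..<k}" for \<sigma>
    using P[OF that] by (auto simp: w_def)
  show ?thesis
  proof (intro exI[of _ w] conjI allI impI)
    show "w \<sigma> \<in> carrier R" if "\<sigma> permutes {..<k}" for \<sigma> by (rule w[OF that])
    fix v assume "\<forall>t<k. v t \<in> carrier R"
    then have v: "v t \<in> carrier R" if "t < k" for t using that by blast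
    show "ring_det R k (A(s\<^sub>0 := v)) = (\<Oplus>\<sigma>\<in>{\<sigma>. \<sigma> permutes {..<k}}. v (\<sigma> s\<^sub>0) \<otimes> w \<sigma>)"
      unfolding ring_det_def
    proof (intro finsum_cong' refl)
      fix \<sigma> assume "\<sigma> \<in> {\<sigma>. \<sigma> permutes {..<k}}"
      then have \<sigma>: "\<sigma> permutes {..<k}" by simp
      have "(\<Otimes>s\<in>{..<k}. (A(s\<^sub>0 := v)) s (\<sigma> s)) =
          (\<Otimes>s\<in>insert s\<^sub>0 ({..<k} - {s\<^sub>0}). (A(s\<^sub>0 := v)) s (\<sigma> s))"
        using assms(1) by (simp add: insert_absorb)
      also have "\<dots> = v (\<sigma> s\<^sub>0) \<otimes> (\<Otimes>s\<in>{..<k} - {s\<^sub>0}. (A(s\<^sub>0 := v)) s (\<sigma> s))"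
        using A v lt[OF \<sigma>] assms(1) by (subst finprod_insert) auto
      also have "(\<Otimes>s\<in>{..<k} - {s\<^sub>0}. (A(s\<^sub>0 := v)) s (\<sigma> s)) = (\<Otimes>s\<in>{..<k} - {s\<^sub>0}. A s (\<sigma> s))"
        using A lt[OF \<sigma>] by (intro finprod_cong') auto
      finally show "(if evenperm \<sigma> then \<one> else \<ominus> \<one>) \<otimes> (\<Otimes>s\<in>{..<k}. (A(s\<^sub>0 := v)) s (\<sigma> s)) =
          v (\<sigma> s\<^sub>0) \<otimes> w \<sigma>"
        using P[OF \<sigma>] v[OF lt[OF \<sigma> assms(1)]] by (simp add: w_def m_lcomm)
    qed (use assms(1) in \<open>auto intro!: w v lt\<close>)
  qed
qed

lemma ring_det_row_sum:
  assumes "s\<^sub>0 < k" "finite N"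
    and A: "\<And>s t. s < k \<Longrightarrow> t < k \<Longrightarrow> s \<noteq> s\<^sub>0 \<Longrightarrow> A s t \<in> carrier R"
    and c: "\<And>i. i \<in> N \<Longrightarrow> c i \<in> carrier R"
    and B: "\<And>i t. i \<in> N \<Longrightarrow> t < k \<Longrightarrow> B i t \<in> carrier R"
  shows "ring_det R k (A(s\<^sub>0 := (\<lambda>t. \<Oplus>i\<in>N. c i \<otimes> B i t))) =
    (\<Oplus>i\<in>N. c i \<otimes> ring_det R k (A(s\<^sub>0 := B i)))"
proof -
  let ?P = "{\<sigma>. \<sigma> permutes {..<k}}"
  have "\<exists>w. (\<forall>\<sigma>. \<sigma> permutes {..<k} \<longrightarrow> w \<sigma> \<in> carrier R) \<and>
    (\<forall>v. (\<forall>t<k. v t \<in> carrier R) \<longrightarrow>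
      ring_det R k (A(s\<^sub>0 := v)) = (\<Oplus>\<sigma>\<in>?P. v (\<sigma> s\<^sub>0) \<otimes> w \<sigma>))"
    by (rule ring_det_linear_form_in_row) (rule assms(1), rule A)
  then obtain w where w': "\<forall>\<sigma>. \<sigma> permutes {..<k} \<longrightarrow> w \<sigma> \<in> carrier R"
    and lin': "\<forall>v. (\<forall>t<k. v t \<in> carrier R) \<longrightarrow>
      ring_det R k (A(s\<^sub>0 := v)) = (\<Oplus>\<sigma>\<in>?P. v (\<sigma> s\<^sub>0) \<otimes> w \<sigma>)"
    by (elim exE conjE)
  have w: "w \<sigma> \<in> carrier R" if "\<sigma> permutes {..<k}" for \<sigma>
    using w' that by blast
  have lin: "ring_det R k (A(s\<^sub>0 := v)) = (\<Oplus>\<sigma>\<in>?P. v (\<sigma> s\<^sub>0) \<otimes> w \<sigma>)"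
    if "\<And>t. t < k \<Longrightarrow> v t \<in> carrier R" for v
    using lin'[rule_format, of v] that by blast
  have lt: "\<sigma> s\<^sub>0 < k" if "\<sigma> permutes {..<k}" for \<sigma>
    using that permutes_in_image[of \<sigma> "{..<k}" s\<^sub>0] assms(1) by auto
  have fin: "finite ?P" by (simp add: finite_permutations)
  have "ring_det R k (A(s\<^sub>0 := (\<lambda>t. \<Oplus>i\<in>N. c i \<otimes> B i t))) =
      (\<Oplus>\<sigma>\<in>?P. (\<Oplus>i\<in>N. c i \<otimes> B i (\<sigma> s\<^sub>0)) \<otimes> w \<sigma>)"
    using c B by (intro lin finsum_closed) auto
  also have "\<dots> = (\<Oplus>\<sigma>\<in>?P. \<Oplus>i\<in>N. c i \<otimes> (B i (\<sigma> s\<^sub>0) \<otimes> w \<sigma>))"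
    using c B w lt assms(2)
    by (intro finsum_cong' refl)
       (auto simp: finsum_ldistr Pi_iff m_assoc intro!: finsum_closed finsum_cong')
  also have "\<dots> = (\<Oplus>i\<in>N. \<Oplus>\<sigma>\<in>?P. c i \<otimes> (B i (\<sigma> s\<^sub>0) \<otimes> w \<sigma>))"
    using c B w lt assms(2) fin by (intro finsum_swap) auto
  also have "\<dots> = (\<Oplus>i\<in>N. c i \<otimes> (\<Oplus>\<sigma>\<in>?P. B i (\<sigma> s\<^sub>0) \<otimes> w \<sigma>))"
    using c B w lt assms(2) fin
    by (intro finsum_cong' refl)
       (auto simp: finsum_rdistr Pi_iff intro!: finsum_closed)
  also have "\<dots> = (\<Oplus>i\<in>N. c i \<otimes> ring_det R k (A(s\<^sub>0 := B i)))"
    using c B w lt by (intro finsum_cong' refl) (auto simp: lin intro!: finsum_closed)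
  finally show ?thesis .
qed

lemma ring_det_transpose:
  assumes A: "\<And>s t. s < k \<Longrightarrow> t < k \<Longrightarrow> A s t \<in> carrier R"
  shows "ring_det R k (\<lambda>s t. A t s) = ring_det R k A"
proof -
  let ?P = "{\<sigma>. \<sigma> permutes {..<k}}"
  let ?T = "\<lambda>B \<sigma>. (if evenperm \<sigma> then \<one> else \<ominus> \<one>) \<otimes> (\<Otimes>s\<in>{..<k}. B s (\<sigma> s))"
  have lt: "\<sigma> s < k" if "\<sigma> permutes {..<k}" "s < k" for s and \<sigma> :: "nat \<Rightarrow> nat"
    using that permutes_in_image[of \<sigma> "{..<k}" s] by auto
  have eq: "?T (\<lambda>s t. A t s) \<sigma> = ?T A (inv_into UNIV \<sigma>)" if \<sigma>: "\<sigma> permutes {..<k}" for \<sigma>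
  proof -
    have inv: "inv_into UNIV \<sigma> permutes {..<k}" using \<sigma> by (rule permutes_inv)
    have "(\<Otimes>s\<in>{..<k}. A s (inv_into UNIV \<sigma> s)) = (\<Otimes>s\<in>\<sigma> ` {..<k}. A s (inv_into UNIV \<sigma> s))"
      using \<sigma> by (simp add: permutes_image)
    also have "\<dots> = (\<Otimes>s\<in>{..<k}. A (\<sigma> s) (inv_into UNIV \<sigma> (\<sigma> s)))"
      using A lt[OF \<sigma>] lt[OF inv] permutes_inj_on[OF \<sigma>] by (intro finprod_reindex) auto
    also have "\<dots> = (\<Otimes>s\<in>{..<k}. A (\<sigma> s) s)"
      using \<sigma> by (simp add: permutes_inverses(2))
    finally have "(\<Otimes>s\<in>{..<k}. A s (inv_into UNIV \<sigma> s)) = (\<Otimes>s\<in>{..<k}. A (\<sigma> s) s)" .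
    moreover have "evenperm (inv_into UNIV \<sigma>) = evenperm \<sigma>"
      using \<sigma> by (intro evenperm_inv) (auto simp: permutation_permutes)
    ultimately show ?thesis by simp
  qed
  have T: "?T A \<sigma> \<in> carrier R" if "\<sigma> permutes {..<k}" for \<sigma>
    using A lt[OF that] by (auto intro!: finprod_closed m_closed)
  have "ring_det R k (\<lambda>s t. A t s) = (\<Oplus>\<sigma>\<in>?P. ?T A (inv_into UNIV \<sigma>))"
    unfolding ring_det_def using eq T permutes_inv[of _ "{..<k}"] by (intro finsum_cong' refl) auto
  also have "\<dots> = (\<Oplus>\<sigma>\<in>inv_into UNIV ` ?P. ?T A \<sigma>)"
    using T permutes_inv[of _ "{..<k}"] inv_inj_on_permutes[of "{..<k}"]
    by (intro finsum_reindex[symmetric]) auto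
  also have "inv_into UNIV ` ?P = ?P"
  proof (intro equalityI subsetI)
    fix \<sigma> assume "\<sigma> \<in> ?P"
    then show "\<sigma> \<in> inv_into UNIV ` ?P"
      by (intro image_eqI[of _ _ "inv_into UNIV \<sigma>"]) (simp_all add: permutes_inv permutes_inv_inv)
  qed (auto intro: permutes_inv)
  finally show ?thesis by (simp add: ring_det_def)
qed

text \<open>
  Composition with the transposition of the two equal rows pairs each even permutation with an
  odd one that contributes the same product with the opposite sign.
\<close>

lemma ring_det_equal_rows:
  assumes ab: "a < k" "b < k" "a \<noteq> b"
    and A: "\<And>s t. s < k \<Longrightarrow> t < k \<Longrightarrow> A s t \<in> carrier R"
    and eq: "\<And>t. t < k \<Longrightarrow> A a t = A b t"
  shows "ring_det R k A = \<zero>"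
proof -
  let ?P = "{\<sigma>. \<sigma> permutes {..<k}}"
  let ?E = "{\<sigma>\<in>?P. evenperm \<sigma>}" and ?O = "{\<sigma>\<in>?P. \<not> evenperm \<sigma>}"
  let ?T = "\<lambda>\<sigma>. (if evenperm \<sigma> then \<one> else \<ominus> \<one>) \<otimes> (\<Otimes>s\<in>{..<k}. A s (\<sigma> s))"
  define \<tau> where "\<tau> = Transposition.transpose a b"
  have \<tau>: "\<tau> permutes {..<k}"
    using ab by (auto simp: \<tau>_def intro: permutes_swap_id)
  have lt: "\<sigma> s < k" if "\<sigma> permutes {..<k}" "s < k" for s and \<sigma> :: "nat \<Rightarrow> nat"
    using that permutes_in_image[of \<sigma> "{..<k}" s] by auto
  have T: "?T \<sigma> \<in> carrier R" if "\<sigma> permutes {..<k}" for \<sigma>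
    using A lt[OF that] by (auto intro!: finprod_closed m_closed)
  have fin: "finite ?P" by (simp add: finite_permutations)
  have even: "evenperm (\<sigma> \<circ> \<tau>) \<longleftrightarrow> \<not> evenperm \<sigma>" if "\<sigma> permutes {..<k}" for \<sigma>
    using evenperm_comp[of \<sigma> \<tau>] that \<tau> ab(3)
    by (auto simp: permutation_permutes \<tau>_def evenperm_swap)
  have inv: "\<sigma> \<circ> \<tau> \<circ> \<tau> = \<sigma>" for \<sigma> :: "nat \<Rightarrow> nat"
    by (auto simp: \<tau>_def fun_eq_iff)
  have Oim: "?O = (\<lambda>\<sigma>. \<sigma> \<circ> \<tau>) ` ?E"
  proof (intro equalityI subsetI)
    fix \<sigma> assume "\<sigma> \<in> ?O"
    then have "\<sigma> \<circ> \<tau> \<in> ?E" using even \<tau> by (auto intro: permutes_compose)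
    then show "\<sigma> \<in> (\<lambda>\<sigma>. \<sigma> \<circ> \<tau>) ` ?E" using inv[of \<sigma>] by (auto intro!: rev_image_eqI)
  qed (use even \<tau> in \<open>auto intro: permutes_compose\<close>)
  have neg: "?T (\<sigma> \<circ> \<tau>) = \<ominus> ?T \<sigma>" if \<sigma>: "\<sigma> permutes {..<k}" for \<sigma>
  proof -
    have row: "A (\<tau> s) t = A s t" if "t < k" for s t
      using eq[OF that] by (auto simp: \<tau>_def Transposition.transpose_def)
    have "(\<Otimes>s\<in>{..<k}. A s (\<sigma> s)) = (\<Otimes>s\<in>\<tau> ` {..<k}. A s (\<sigma> s))"
      using \<tau> by (simp add: permutes_image)
    also have "\<dots> = (\<Otimes>s\<in>{..<k}. A (\<tau> s) (\<sigma> (\<tau> s)))"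
      using A lt[OF \<tau>] lt[OF \<sigma>] permutes_inj_on[OF \<tau>] by (intro finprod_reindex) auto
    also have "\<dots> = (\<Otimes>s\<in>{..<k}. A s ((\<sigma> \<circ> \<tau>) s))"
      using A row lt[OF \<tau>] lt[OF \<sigma>] by (intro finprod_cong') auto
    finally show ?thesis
      using even[OF \<sigma>] A lt[OF \<tau>] lt[OF \<sigma>] by (auto simp: l_minus minus_minus)
  qed
  have "ring_det R k A = (\<Oplus>\<sigma>\<in>?E \<union> ?O. ?T \<sigma>)"
    unfolding ring_det_def by (rule arg_cong[where f = "finsum R ?T"]) auto
  also have "\<dots> = (\<Oplus>\<sigma>\<in>?E. ?T \<sigma>) \<oplus> (\<Oplus>\<sigma>\<in>?O. ?T \<sigma>)"
    using fin T by (intro finsum_Un_disjoint) auto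
  also have "(\<Oplus>\<sigma>\<in>?O. ?T \<sigma>) = (\<Oplus>\<sigma>\<in>?E. ?T (\<sigma> \<circ> \<tau>))"
    unfolding Oim
  proof (rule finsum_reindex)
    show "inj_on (\<lambda>\<sigma>. \<sigma> \<circ> \<tau>) ?E"
      by (rule inj_onI) (metis inv)
  qed (use T \<tau> in \<open>auto intro: permutes_compose\<close>)
  also have "\<dots> = (\<Oplus>\<sigma>\<in>?E. \<ominus> ?T \<sigma>)"
    using neg T by (intro finsum_cong' refl) auto
  also have "(\<Oplus>\<sigma>\<in>?E. ?T \<sigma>) \<oplus> \<dots> = (\<Oplus>\<sigma>\<in>?E. ?T \<sigma> \<oplus> \<ominus> ?T \<sigma>)"
    using T by (intro finsum_addf[symmetric]) auto
  also have "\<dots> = (\<Oplus>\<sigma>\<in>?E. \<zero>)"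
    by (intro finsum_cong' refl r_neg T) auto
  finally show ?thesis by simp
qed

lemma ring_det_diagonal:
  assumes a: "\<And>s. s < k \<Longrightarrow> a s \<in> carrier R"
  shows "ring_det R k (\<lambda>s t. if s = t then a s else \<zero>) = (\<Otimes>s\<in>{..<k}. a s)"
proof -
  let ?P = "{\<sigma>. \<sigma> permutes {..<k}}"
  let ?T = "\<lambda>\<sigma>. (if evenperm \<sigma> then \<one> else \<ominus> \<one>) \<otimes> (\<Otimes>s\<in>{..<k}. if s = \<sigma> s then a s else \<zero>)"
  have T: "?T \<sigma> \<in> carrier R" for \<sigma>
    using a by (auto intro!: finprod_closed m_closed)
  have "?T \<sigma> = \<zero>" if "\<sigma> permutes {..<k}" "\<sigma> \<noteq> id" for \<sigma>
  proof -
    obtain s where s: "\<sigma> s \<noteq> s" using \<open>\<sigma> \<noteq> id\<close> by (auto simp: fun_eq_iff)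
    then have "s < k" using that(1) by (meson lessThan_iff permutes_not_in)
    have "(\<Otimes>s\<in>{..<k}. if s = \<sigma> s then a s else \<zero>) =
        (\<Otimes>s\<in>insert s ({..<k} - {s}). if s = \<sigma> s then a s else \<zero>)"
      using \<open>s < k\<close> by (simp add: insert_absorb)
    also have "\<dots> = \<zero>"
    proof (subst finprod_insert)
      have "(\<Otimes>s\<in>{..<k} - {s}. if s = \<sigma> s then a s else \<zero>) \<in> carrier R"
        using a by (intro finprod_closed) auto
      then show "(if s = \<sigma> s then a s else \<zero>) \<otimes>
          (\<Otimes>s\<in>{..<k} - {s}. if s = \<sigma> s then a s else \<zero>) = \<zero>"
        using s by simp
    qed (use a s in auto)
    finally show ?thesis by simp
  qed
  then have "finsum R ?T ?P = ?T id"
    using T by (intro finsum_single) (simp_all add: permutes_id finite_permutations)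
  also have "\<dots> = (\<Otimes>s\<in>{..<k}. a s)"
    using a by (auto intro!: finprod_closed)
  finally show ?thesis by (simp add: ring_det_def)
qed

text \<open>
  A substitute for the Cauchy-Binet formula, at the level of ideals.
  The rows are expanded one after the other: the invariant of the induction is that the first \<open>j\<close>
  rows are the given linear combinations and the others are still taken from \<open>B\<close>. A choice of rows
  of \<open>B\<close> with a repetition contributes nothing.
\<close>

lemma ring_det_rows_in_span:
  assumes P: "ideal P R" and "finite N"
    and A: "\<And>s t. s < k \<Longrightarrow> t < k \<Longrightarrow> A s t = (\<Oplus>i\<in>N. c s i \<otimes> B i t)"
    and c: "\<And>s i. s < k \<Longrightarrow> i \<in> N \<Longrightarrow> c s i \<in> carrier R"
    and B: "\<And>i t. i \<in> N \<Longrightarrow> t < k \<Longrightarrow> B i t \<in> carrier R"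
    and minor: "\<And>g. inj_on g {..<k} \<Longrightarrow> g ` {..<k} \<subseteq> N \<Longrightarrow> ring_det R k (\<lambda>s. B (g s)) \<in> P"
  shows "ring_det R k A \<in> P"
proof -
  interpret P: ideal P R by (rule P)
  define C where "C s t = (\<Oplus>i\<in>N. c s i \<otimes> B i t)" for s t
  have C: "C s t \<in> carrier R" if "s < k" "t < k" for s t
    unfolding C_def using that c B by (intro finsum_closed) auto
  have "ring_det R k (\<lambda>s. if s < j then C s else B (g s)) \<in> P"
    if "j \<le> k" "g ` {..<k} \<subseteq> N" for j g
    using that
  proof (induction j arbitrary: g)
    case 0
    show ?case
    proof (cases "inj_on g {..<k}")
      case True
      then show ?thesis using minor[of g] 0 by simp
    next
      case False
      then obtain a b where "a < k" "b < k" "a \<noteq> b" "g a = g b"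
        by (auto simp: inj_on_def)
      then have "ring_det R k (\<lambda>s. B (g s)) = \<zero>"
        using 0 B by (intro ring_det_equal_rows[of a k b]) auto
      then show ?thesis by (simp add: P.zero_closed)
    qed
  next
    case (Suc j)
    let ?A = "\<lambda>s. if s < j then C s else B (g s)"
    have eq: "(\<lambda>s. if s < Suc j then C s else B (g s)) = ?A(j := (\<lambda>t. \<Oplus>i\<in>N. c j i \<otimes> B i t))"
      by (auto simp: fun_eq_iff C_def less_Suc_eq)
    have in_P: "ring_det R k (?A(j := B i)) \<in> P" if "i \<in> N" for i
    proof -
      have "?A(j := B i) = (\<lambda>s. if s < j then C s else B ((g(j := i)) s))"
        by (auto simp: fun_eq_iff)
      moreover have "(g(j := i)) ` {..<k} \<subseteq> N" using Suc.prems that by auto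
      ultimately show ?thesis using Suc.IH[of "g(j := i)"] Suc.prems(1) by simp
    qed
    have "ring_det R k (?A(j := (\<lambda>t. \<Oplus>i\<in>N. c j i \<otimes> B i t))) =
        (\<Oplus>i\<in>N. c j i \<otimes> ring_det R k (?A(j := B i)))"
      using Suc.prems assms(2) c B C by (intro ring_det_row_sum) auto
    also have "\<dots> \<in> P"
      using in_P c Suc.prems(1) by (intro ideal_finsum_closed[OF P]) (auto intro: P.I_l_closed)
    finally show ?case using eq by simp
  qed
  note expand = this
  show ?thesis
  proof (cases "N = {} \<and> k \<noteq> 0")
    case True
    have "ring_det R k A = ring_det R k (\<lambda>s t. if s = t then \<zero> else \<zero>)"
      using A True by (intro ring_det_cong) auto
    also have "\<dots> = (\<Otimes>s\<in>{..<k}. \<zero>)" by (rule ring_det_diagonal) simp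
    also have "\<dots> = \<zero>"
      using True by (simp add: finprod_const nat_pow_zero)
    finally show ?thesis by (simp add: P.zero_closed)
  next
    case False
    then have "(\<lambda>_::nat. SOME i. i \<in> N) ` {..<k} \<subseteq> N"
      by (auto simp: some_in_eq)
    then obtain g :: "nat \<Rightarrow> _" where g: "g ` {..<k} \<subseteq> N" by blast
    have "ring_det R k A = ring_det R k (\<lambda>s. if s < k then C s else B (g s))"
      using C A by (intro ring_det_cong) (simp_all add: C_def)
    also have "\<dots> \<in> P" using g by (intro expand) auto
    finally show ?thesis .
  qed
qed

end

section \<open>Ideals of minors of a logarithmic submodule\<close>

definition mat_vec :: "('a, 'b) ring_scheme \<Rightarrow> ('n \<Rightarrow> 'n \<Rightarrow> 'a) \<Rightarrow> 'a ^ 'n \<Rightarrow> 'a ^ 'n" where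
  "mat_vec R M v = (\<chi> i. \<Oplus>\<^bsub>R\<^esub>j\<in>UNIV. M i j \<otimes>\<^bsub>R\<^esub> v $ j)"

text \<open>
  These generate the ideal of minors of \<open>L\<close> without the choice of a generating family.
\<close>

definition minors_of :: "('a, 'b) ring_scheme \<Rightarrow> nat \<Rightarrow> ('a ^ 'n) set \<Rightarrow> 'a set" where
  "minors_of R k L =
     {ring_det R k (\<lambda>s t. \<eta> t $ r s) | r \<eta>. inj_on r {..<k} \<and> (\<forall>t<k. \<eta> t \<in> L)}"

definition lin_span :: "('a, 'b) ring_scheme \<Rightarrow> nat \<Rightarrow> (nat \<Rightarrow> 'a ^ 'n) \<Rightarrow> ('a ^ 'n) set" where
  "lin_span R m \<eta> =
     {(\<chi> i. \<Oplus>\<^bsub>R\<^esub>j\<in>{..<m}. c j \<otimes>\<^bsub>R\<^esub> \<eta> j $ i) | c. \<forall>j<m. c j \<in> carrier R}"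

text \<open>
  The algebraic model of \<open>Der(-log X)\<close>: the matrix \<open>J\<close> is the Jacobian of straightening coordinates,
  \<open>I\<close> is the ideal of \<open>X\<close>.
\<close>

definition log_submodule ::
  "('a, 'b) ring_scheme \<Rightarrow> ('n \<Rightarrow> 'n \<Rightarrow> 'a) \<Rightarrow> 'n set \<Rightarrow> 'a set \<Rightarrow> ('a ^ 'n) set" where
  "log_submodule R J S I =
     {\<eta>. (\<forall>i. \<eta> $ i \<in> carrier R) \<and> (\<forall>i. i \<notin> S \<longrightarrow> mat_vec R J \<eta> $ i \<in> I)}"

context cring
begin

lemma one_ideals_set [simp]: "\<one>\<^bsub>ideals_set R\<^esub> = carrier R"
  by (simp add: ideals_set_def)

lemma mult_ideals_set [simp]: "P \<otimes>\<^bsub>ideals_set R\<^esub> Q = ideal_prod R P Q"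
  by (simp add: ideals_set_def)

lemma ideal_ideals_pow: "ideal I R \<Longrightarrow> ideal (I [^]\<^bsub>ideals_set R\<^esub> (n::nat)) R"
  by (induction n) (simp_all add: oneideal ideal_prod_is_ideal)

lemma ideals_pow_antimono:
  assumes "ideal I R" "m \<le> n"
  shows "I [^]\<^bsub>ideals_set R\<^esub> n \<subseteq> I [^]\<^bsub>ideals_set R\<^esub> (m::nat)"
  using assms(2)
proof (induction n rule: dec_induct)
  case (step n)
  have "I [^]\<^bsub>ideals_set R\<^esub> Suc n \<subseteq> I [^]\<^bsub>ideals_set R\<^esub> n"
    using ideal_prod_inter[OF ideal_ideals_pow[OF assms(1)] assms(1)] by auto
  then show ?case using step by blast
qed simp

lemma finprod_in_ideals_pow:
  assumes "ideal I R" "finite A" "T \<subseteq> A" "a \<in> A \<rightarrow> carrier R" "\<And>i. i \<in> T \<Longrightarrow> a i \<in> I"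
  shows "(\<Otimes>i\<in>A. a i) \<in> I [^]\<^bsub>ideals_set R\<^esub> card T"
  using assms(2-)
proof (induction A arbitrary: T rule: finite_induct)
  case empty
  then show ?case by simp
next
  case (insert x A)
  have prod: "(\<Otimes>i\<in>insert x A. a i) = a x \<otimes> (\<Otimes>i\<in>A. a i)"
    using insert by (intro finprod_insert) auto
  have closed: "(\<Otimes>i\<in>A. a i) \<in> carrier R" "a x \<in> carrier R"
    using insert by (auto intro!: finprod_closed)
  have IH: "(\<Otimes>i\<in>A. a i) \<in> I [^]\<^bsub>ideals_set R\<^esub> card (T - {x})"
    using insert by (intro insert.IH) auto
  show ?case
  proof (cases "x \<in> T")
    case True
    have "finite T" using insert.hyps(1) insert.prems(1) by (auto intro: finite_subset)
    then have card: "card T = Suc (card (T - {x}))" using card.remove[OF \<open>finite T\<close> True] by simp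
    have "(\<Otimes>i\<in>A. a i) \<otimes> a x \<in> ideal_prod R (I [^]\<^bsub>ideals_set R\<^esub> card (T - {x})) I"
      using IH insert.prems(3)[OF True] by (rule ideal_prod.prod)
    then show ?thesis using prod closed by (simp add: card m_comm)
  next
    case False
    then show ?thesis
      using IH prod closed(2) ideal.I_l_closed[OF ideal_ideals_pow[OF assms(1)]] by simp
  qed
qed

text \<open>
  A power of \<open>I\<close> is contained in an ideal as soon as all products of elements of \<open>I\<close> are.
  The factor \<open>b\<close> serves the induction: the last factor of a product moves into it.
\<close>

lemma ideals_pow_subset_by_products:
  assumes "ideal Q R" "ideal I R" "b \<in> carrier R" "x \<in> I [^]\<^bsub>ideals_set R\<^esub> (m::nat)"
    and "\<And>a. (\<And>l. l < m \<Longrightarrow> a l \<in> I) \<Longrightarrow> b \<otimes> (\<Otimes>l\<in>{..<m}. a l) \<in> Q"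
  shows "b \<otimes> x \<in> Q"
  using assms(3-)
proof (induction m arbitrary: b x)
  case 0
  then have "b \<in> Q" using 0(3)[of "\<lambda>_. \<zero>"] by simp
  then show ?case using 0(2) ideal.I_r_closed[OF assms(1)] by simp
next
  case (Suc m)
  interpret I: ideal I R by (rule assms(2))
  interpret Q: ideal Q R by (rule assms(1))
  interpret Im: ideal "I [^]\<^bsub>ideals_set R\<^esub> m" R by (rule ideal_ideals_pow[OF assms(2)])
  interpret Im1: ideal "I [^]\<^bsub>ideals_set R\<^esub> Suc m" R by (rule ideal_ideals_pow[OF assms(2)])
  have "x \<in> ideal_prod R (I [^]\<^bsub>ideals_set R\<^esub> m) I" using Suc.prems(2) by simp
  then show ?case
  proof induction
    case (prod y z)
    have "(b \<otimes> z) \<otimes> y \<in> Q"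
    proof (rule Suc.IH[OF _ prod(1)])
      fix a assume a: "\<And>l. l < m \<Longrightarrow> a l \<in> I"
      let ?a = "\<lambda>l. if l < m then a l else z"
      have closed: "(\<Otimes>l\<in>{..<m}. a l) \<in> carrier R"
        using a I.Icarr by (intro finprod_closed) auto
      have "(\<Otimes>l\<in>{..<Suc m}. ?a l) = ?a m \<otimes> (\<Otimes>l\<in>{..<m}. ?a l)"
        unfolding lessThan_Suc using a prod(2) I.Icarr by (intro finprod_insert) auto
      also have "(\<Otimes>l\<in>{..<m}. ?a l) = (\<Otimes>l\<in>{..<m}. a l)"
        using a I.Icarr by (intro finprod_cong') auto
      finally have eq: "(\<Otimes>l\<in>{..<Suc m}. ?a l) = z \<otimes> (\<Otimes>l\<in>{..<m}. a l)" by simp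
      have "b \<otimes> (\<Otimes>l\<in>{..<Suc m}. ?a l) \<in> Q"
        using a prod(2) by (intro Suc.prems(3)) auto
      then show "b \<otimes> z \<otimes> (\<Otimes>l\<in>{..<m}. a l) \<in> Q"
        unfolding eq using Suc.prems(1) I.Icarr[OF prod(2)] closed by (simp add: m_assoc)
    qed (use Suc.prems(1) I.Icarr[OF prod(2)] in simp)
    moreover have "b \<otimes> (y \<otimes> z) = (b \<otimes> z) \<otimes> y"
      using Suc.prems(1) I.Icarr[OF prod(2)] Im.Icarr[OF prod(1)] by (simp add: m_ac)
    ultimately show ?case by simp
  next
    case (sum s1 s2)
    have "s1 \<in> carrier R" "s2 \<in> carrier R"
      using sum(1,2) Im1.Icarr by auto
    then show ?case using sum Suc.prems(1) by (simp add: r_distr Q.a_closed)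
  qed
qed

lemma mat_vec_closed:
  assumes "\<And>i j. M i j \<in> carrier R" "\<And>i. v $ i \<in> carrier R"
  shows "mat_vec R M v $ i \<in> carrier R"
  using assms by (simp add: mat_vec_def finsum_closed)

lemma mat_vec_inverse:
  fixes M N :: "'n::finite \<Rightarrow> 'n \<Rightarrow> 'a"
  assumes M: "\<And>i j. M i j \<in> carrier R" and N: "\<And>i j. N i j \<in> carrier R"
    and v: "\<And>i. v $ i \<in> carrier R"
    and MN: "\<And>i l. (\<Oplus>j\<in>UNIV. M i j \<otimes> N j l) = (if i = l then \<one> else \<zero>)"
  shows "mat_vec R M (mat_vec R N v) = v"
proof (rule vec_eq_iff[THEN iffD2], rule allI)
  fix i
  have "mat_vec R M (mat_vec R N v) $ i = (\<Oplus>j\<in>UNIV. \<Oplus>l\<in>UNIV. M i j \<otimes> N j l \<otimes> v $ l)"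
    unfolding mat_vec_def vec_lambda_beta using M N v
    by (intro finsum_cong' refl) (auto simp: finsum_rdistr m_assoc Pi_iff intro!: finsum_closed)
  also have "\<dots> = (\<Oplus>l\<in>UNIV. \<Oplus>j\<in>UNIV. M i j \<otimes> N j l \<otimes> v $ l)"
    using M N v by (intro finsum_swap) auto
  also have "\<dots> = (\<Oplus>l\<in>UNIV. (if i = l then \<one> else \<zero>) \<otimes> v $ l)"
    using M N v by (intro finsum_cong' refl) (auto simp: finsum_ldistr[symmetric] MN)
  also have "\<dots> = (if i = i then \<one> else \<zero>) \<otimes> v $ i"
    using v by (intro finsum_single) auto
  finally show "mat_vec R M (mat_vec R N v) $ i = v $ i" using v by simp
qed

lemma minors_of_subset_carrier:
  assumes "\<And>\<eta> i. \<eta> \<in> L \<Longrightarrow> \<eta> $ i \<in> carrier R"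
  shows "minors_of R k L \<subseteq> carrier R"
  using assms by (auto simp: minors_of_def intro!: ring_det_closed)

text \<open>
  With \<open>\<theta> = J \<eta>\<close> the condition on \<open>\<eta>\<close> becomes \<open>\<theta>\<^sub>i \<in> I\<close> for \<open>i \<notin> S\<close>, and the minors of the \<open>\<eta>\<close> and
  those of the \<open>\<theta>\<close> lie in the same ideals. The truncated difference covers the case
  \<open>k \<le> card S\<close>, in which the right-hand side is the whole ring.
\<close>

theorem ideal_of_minors_log_submodule:
  fixes J K :: "'n::finite \<Rightarrow> 'n \<Rightarrow> 'a"
  assumes I: "ideal I R"
    and J: "\<And>i j. J i j \<in> carrier R" and K: "\<And>i j. K i j \<in> carrier R"
    and JK: "\<And>i l. (\<Oplus>j\<in>UNIV. J i j \<otimes> K j l) = (if i = l then \<one> else \<zero>)"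
    and KJ: "\<And>i l. (\<Oplus>j\<in>UNIV. K i j \<otimes> J j l) = (if i = l then \<one> else \<zero>)"
    and k: "k \<le> CARD('n)"
  shows "Idl (minors_of R k (log_submodule R J S I)) = I [^]\<^bsub>ideals_set R\<^esub> (k - card S)"
proof (intro equalityI)
  let ?L = "log_submodule R J S I"
  interpret I: ideal I R by (rule I)
  interpret Im: ideal "I [^]\<^bsub>ideals_set R\<^esub> (k - card S)" R by (rule ideal_ideals_pow[OF I])
  have L: "\<eta> $ i \<in> carrier R" if "\<eta> \<in> ?L" for \<eta> i
    using that by (simp add: log_submodule_def)
  have sub: "minors_of R k ?L \<subseteq> carrier R" by (rule minors_of_subset_carrier[OF L])
  show "Idl (minors_of R k ?L) \<subseteq> I [^]\<^bsub>ideals_set R\<^esub> (k - card S)"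
  proof (rule genideal_minimal[OF Im.is_ideal], rule subsetI)
    fix x assume "x \<in> minors_of R k ?L"
    then obtain r \<eta> where x: "x = ring_det R k (\<lambda>s t. \<eta> t $ r s)"
      and \<eta>: "\<And>t. t < k \<Longrightarrow> \<eta> t \<in> ?L"
      by (auto simp: minors_of_def)
    define \<theta> where "\<theta> t = mat_vec R J (\<eta> t)" for t
    have \<theta>: "\<theta> t $ i \<in> carrier R" if "t < k" for t i
      unfolding \<theta>_def using J L[OF \<eta>[OF that]] by (intro mat_vec_closed) auto
    have \<theta>I: "\<theta> t $ i \<in> I" if "t < k" "i \<notin> S" for t i
      using \<eta>[OF that(1)] that(2) by (simp add: log_submodule_def \<theta>_def)
    have \<eta>\<theta>: "\<eta> t = mat_vec R K (\<theta> t)" if "t < k" for t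
      unfolding \<theta>_def using J K L[OF \<eta>[OF that]] KJ by (intro mat_vec_inverse[symmetric]) auto
    show "x \<in> I [^]\<^bsub>ideals_set R\<^esub> (k - card S)"
      unfolding x
    proof (rule ring_det_rows_in_span[where N = UNIV and c = "\<lambda>s i. K (r s) i" and B = "\<lambda>i t. \<theta> t $ i"])
      show "\<eta> t $ r s = (\<Oplus>i\<in>UNIV. K (r s) i \<otimes> \<theta> t $ i)" if "t < k" for s t
        using \<eta>\<theta>[OF that] by (simp add: mat_vec_def)
    next
      fix g :: "nat \<Rightarrow> 'n" assume g: "inj_on g {..<k}"
      \<comment> \<open>Injectivity of \<open>g\<close> leaves room for at most \<open>card S\<close> rows with index in \<open>S\<close>.\<close>
      define T where "T = {s\<in>{..<k}. g s \<notin> S}"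
      have "card {s\<in>{..<k}. g s \<in> S} \<le> card S"
        using g by (intro card_inj_on_le[of g]) (auto intro: inj_on_subset)
      moreover have "card T + card {s\<in>{..<k}. g s \<in> S} = k"
        unfolding T_def by (subst card_Un_disjoint[symmetric]) (auto intro!: arg_cong[of _ _ card, THEN trans[OF _ card_lessThan]])
      ultimately have T: "k - card S \<le> card T" by linarith
      have "(\<Otimes>s\<in>{..<k}. \<theta> (\<sigma> s) $ g s) \<in> I [^]\<^bsub>ideals_set R\<^esub> (k - card S)"
        if "\<sigma> permutes {..<k}" for \<sigma>
      proof -
        have "\<sigma> s < k" if "s < k" for s
          using that \<open>\<sigma> permutes {..<k}\<close> permutes_in_image[of \<sigma> "{..<k}" s] by auto
        then have "(\<Otimes>s\<in>{..<k}. \<theta> (\<sigma> s) $ g s) \<in> I [^]\<^bsub>ideals_set R\<^esub> card T"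
          using \<theta> \<theta>I by (intro finprod_in_ideals_pow[OF I]) (auto simp: T_def)
        then show ?thesis using ideals_pow_antimono[OF I T] by blast
      qed
      then show "ring_det R k (\<lambda>s t. \<theta> t $ g s) \<in> I [^]\<^bsub>ideals_set R\<^esub> (k - card S)"
        unfolding ring_det_def by (intro ideal_finsum_closed[OF Im.is_ideal] Im.I_l_closed) auto
    qed (use K \<theta> Im.is_ideal in auto)
  qed
  show "I [^]\<^bsub>ideals_set R\<^esub> (k - card S) \<subseteq> Idl (minors_of R k ?L)"
  proof
    let ?m = "k - card S"
    interpret Q: ideal "Idl (minors_of R k ?L)" R by (rule genideal_ideal[OF sub])
    fix x assume x: "x \<in> I [^]\<^bsub>ideals_set R\<^esub> ?m"
    have "\<one> \<otimes> x \<in> Idl (minors_of R k ?L)"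
    proof (rule ideals_pow_subset_by_products[OF Q.is_ideal I one_closed x])
      fix a assume a: "\<And>l. l < ?m \<Longrightarrow> a l \<in> I"
      \<comment> \<open>Select \<open>k\<close> distinct rows: the first \<open>k - card S\<close> of them outside \<open>S\<close>, which is possible
        as \<open>k \<le> CARD('n)\<close>, and the others inside \<open>S\<close>.\<close>
      have "card (- S) = CARD('n) - card S" by (simp add: Compl_eq_Diff_UNIV card_Diff_subset)
      then have "\<exists>f. f ` {..<?m} \<subseteq> - S \<and> inj_on f {..<?m}"
        using k by (intro card_le_inj) (simp_all add: diff_le_mono)
      then obtain f1 where f1: "f1 ` {..<?m} \<subseteq> - S" "inj_on f1 {..<?m}" by blast
      have "\<exists>f. f ` {?m..<k} \<subseteq> S \<and> inj_on f {?m..<k}"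
        by (intro card_le_inj) simp_all
      then obtain f2 where f2: "f2 ` {?m..<k} \<subseteq> S" "inj_on f2 {?m..<k}" by blast
      define g where "g s = (if s < ?m then f1 s else f2 s)" for s
      have gS: "g s \<in> S" if "s < k" "\<not> s < ?m" for s
        using f2(1) that by (auto simp: g_def)
      have gS': "g s \<notin> S" if "s < ?m" for s
        using f1(1) that by (auto simp: g_def)
      have g: "inj_on g {..<k}"
      proof (rule inj_onI)
        fix s t assume *: "s \<in> {..<k}" "t \<in> {..<k}" "g s = g t"
        then have "s < ?m \<longleftrightarrow> t < ?m" using gS gS' by (metis lessThan_iff)
        then show "s = t"
          using * inj_onD[OF f1(2), of s t] inj_onD[OF f2(2), of s t]
          by (cases "s < ?m") (auto simp: g_def)
      qed
      define e where "e t = (if t < ?m then a t else \<one>)" for t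
      have e: "e t \<in> carrier R" for t using a I.Icarr by (simp add: e_def)
      \<comment> \<open>In the selected rows these columns form a diagonal matrix with determinant the given product.\<close>
      define \<theta> :: "nat \<Rightarrow> 'a ^ 'n" where "\<theta> t = (\<chi> i. if i = g t then e t else \<zero>)" for t
      define \<eta> where "\<eta> t = mat_vec R K (\<theta> t)" for t
      have \<theta>: "\<theta> t $ i \<in> carrier R" for t i using e by (simp add: \<theta>_def)
      have \<eta>: "\<eta> t $ i \<in> carrier R" for t i unfolding \<eta>_def using K \<theta> by (intro mat_vec_closed)
      have \<theta>\<eta>: "mat_vec R J (\<eta> t) = \<theta> t" for t
        unfolding \<eta>_def using J K \<theta> JK by (intro mat_vec_inverse) auto
      have \<eta>L: "\<eta> t \<in> ?L" if "t < k" for t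
        using \<eta> gS[OF that] a I.zero_closed by (auto simp: log_submodule_def \<theta>\<eta> \<theta>_def e_def)
      have "ring_det R k (\<lambda>s t. \<theta> t $ g s) \<in> Idl (minors_of R k ?L)"
      proof (rule ring_det_rows_in_span[where N = UNIV and c = "\<lambda>s i. J (g s) i" and B = "\<lambda>i t. \<eta> t $ i"])
        show "\<theta> t $ g s = (\<Oplus>i\<in>UNIV. J (g s) i \<otimes> \<eta> t $ i)" for s t
          by (simp flip: \<theta>\<eta> add: mat_vec_def)
      next
        fix h :: "nat \<Rightarrow> 'n" assume "inj_on h {..<k}"
        then have "ring_det R k (\<lambda>s t. \<eta> t $ h s) \<in> minors_of R k ?L"
          using \<eta>L by (auto simp: minors_of_def)
        then show "ring_det R k (\<lambda>s t. \<eta> t $ h s) \<in> Idl (minors_of R k ?L)"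
          using genideal_self[OF sub] by blast
      qed (use J \<eta> Q.is_ideal in auto)
      also have "ring_det R k (\<lambda>s t. \<theta> t $ g s) = ring_det R k (\<lambda>s t. if s = t then e s else \<zero>)"
        using g e by (intro ring_det_cong) (auto simp: \<theta>_def inj_on_eq_iff)
      also have "\<dots> = (\<Otimes>s\<in>{..<k}. e s)" using e by (intro ring_det_diagonal)
      also have "\<dots> = (\<Otimes>l\<in>{..<?m}. a l)"
        using e a I.Icarr by (intro finprod_mono_neutral_cong_right) (auto simp: e_def)
      finally show "\<one> \<otimes> (\<Otimes>l\<in>{..<?m}. a l) \<in> Idl (minors_of R k ?L)"
        using a I.Icarr by (simp add: Pi_iff)
    qed
    then show "x \<in> Idl (minors_of R k ?L)" using Im.Icarr[OF x] by simp
  qed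
qed

text \<open>
  Each column of a minor of \<open>L\<close> is a combination of the generators, so the minor expands into
  minors of the generators; the transpose turns columns into rows for
  \<open>ring_det_rows_in_span\<close>.
\<close>

lemma ideal_of_minors_generating_family:
  fixes \<eta> :: "nat \<Rightarrow> 'a ^ 'n::finite"
  assumes \<eta>: "\<And>j i. j < m \<Longrightarrow> \<eta> j $ i \<in> carrier R"
  shows "Idl {ring_det R k (\<lambda>s t. \<eta> (c t) $ r s) | r c.
            inj_on r {..<k} \<and> inj_on c {..<k} \<and> c ` {..<k} \<subseteq> {..<m}} =
         Idl (minors_of R k (lin_span R m \<eta>))"
    (is "Idl ?D = Idl ?M")
proof -
  have L: "v $ i \<in> carrier R" if "v \<in> lin_span R m \<eta>" for v i
    using that \<eta> by (auto simp: lin_span_def intro!: finsum_closed)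
  have M: "?M \<subseteq> carrier R" by (rule minors_of_subset_carrier[OF L])
  have D: "?D \<subseteq> carrier R" using \<eta> by (auto intro!: ring_det_closed)
  have gen: "\<eta> j \<in> lin_span R m \<eta>" if "j < m" for j
  proof -
    have "(\<Oplus>l\<in>{..<m}. (if l = j then \<one> else \<zero>) \<otimes> \<eta> l $ i) = (if j = j then \<one> else \<zero>) \<otimes> \<eta> j $ i" for i
      using that \<eta> by (intro finsum_single) auto
    then show ?thesis
      using that \<eta> unfolding lin_span_def
      by (intro CollectI exI[of _ "\<lambda>l. if l = j then \<one> else \<zero>"]) (auto simp: vec_eq_iff)
  qed
  have "?D \<subseteq> ?M"
  proof
    fix x assume "x \<in> ?D"
    then obtain r c where "x = ring_det R k (\<lambda>s t. \<eta> (c t) $ r s)" "inj_on r {..<k}" "c ` {..<k} \<subseteq> {..<m}"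
      by blast
    then show "x \<in> ?M"
      using gen unfolding minors_of_def by (intro CollectI exI[of _ r] exI[of _ "\<lambda>t. \<eta> (c t)"]) auto
  qed
  moreover have "?M \<subseteq> Idl ?D"
  proof
    interpret Q: ideal "Idl ?D" R by (rule genideal_ideal[OF D])
    fix x assume "x \<in> ?M"
    then obtain r v where x: "x = ring_det R k (\<lambda>s t. v t $ r s)" and r: "inj_on r {..<k}"
      and v: "\<And>t. t < k \<Longrightarrow> v t \<in> lin_span R m \<eta>"
      by (auto simp: minors_of_def)
    have "\<exists>c. \<forall>t<k. (\<forall>j<m. c t j \<in> carrier R) \<and> v t = (\<chi> i. \<Oplus>j\<in>{..<m}. c t j \<otimes> \<eta> j $ i)"
      using v unfolding lin_span_def by (intro choice_iff'[THEN iffD1]) blast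
    then obtain c where c: "\<And>t j. t < k \<Longrightarrow> j < m \<Longrightarrow> c t j \<in> carrier R"
      and vc: "\<And>t. t < k \<Longrightarrow> v t = (\<chi> i. \<Oplus>j\<in>{..<m}. c t j \<otimes> \<eta> j $ i)"
      by blast
    have "x = ring_det R k (\<lambda>t s. v t $ r s)"
      unfolding x using L[OF v] by (intro ring_det_transpose) auto
    also have "\<dots> \<in> Idl ?D"
    proof (rule ring_det_rows_in_span[where N = "{..<m}" and c = c and B = "\<lambda>j s. \<eta> j $ r s"])
      fix g :: "nat \<Rightarrow> nat" assume g: "inj_on g {..<k}" "g ` {..<k} \<subseteq> {..<m}"
      have "ring_det R k (\<lambda>t s. \<eta> (g t) $ r s) = ring_det R k (\<lambda>s t. \<eta> (g t) $ r s)"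
        using g \<eta> by (intro ring_det_transpose) auto
      also have "\<dots> \<in> ?D" using g r by blast
      finally show "ring_det R k (\<lambda>t s. \<eta> (g t) $ r s) \<in> Idl ?D"
        using genideal_self[OF D] by blast
    qed (use c vc \<eta> Q.is_ideal in auto)
    finally show "x \<in> Idl ?D" .
  qed
  ultimately show ?thesis
    using genideal_minimal[OF genideal_ideal[OF D]] genideal_minimal[OF genideal_ideal[OF M]]
      genideal_self[OF M] by (intro equalityI) blast+
qed

lemma finsum_cartesian_product:
  assumes "finite A" "finite B" "\<And>i j. i \<in> A \<Longrightarrow> j \<in> B \<Longrightarrow> f i j \<in> carrier R"
  shows "(\<Oplus>x\<in>A \<times> B. f (fst x) (snd x)) = (\<Oplus>i\<in>A. \<Oplus>j\<in>B. f i j)"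
  using assms(1,3)
proof (induction A rule: finite_induct)
  case (insert a A)
  have "(\<Oplus>x\<in>insert a A \<times> B. f (fst x) (snd x)) = (\<Oplus>x\<in>Pair a ` B \<union> A \<times> B. f (fst x) (snd x))"
    by (rule arg_cong[where f = "finsum R (\<lambda>x. f (fst x) (snd x))"]) auto
  also have "\<dots> = (\<Oplus>x\<in>Pair a ` B. f (fst x) (snd x)) \<oplus> (\<Oplus>x\<in>A \<times> B. f (fst x) (snd x))"
    using insert assms(2) by (intro finsum_Un_disjoint) auto
  also have "(\<Oplus>x\<in>Pair a ` B. f (fst x) (snd x)) = (\<Oplus>j\<in>B. f a j)"
    using insert by (subst finsum_reindex) (auto simp: inj_on_def)
  finally show ?case
    using insert by (simp add: Pi_iff finsum_closed)
qed simp

text \<open>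
  In terms of \<open>\<theta> = J \<eta>\<close> the submodule is the product of copies of the ring, one for each \<open>i \<in> S\<close>,
  and of copies of \<open>I\<close>, one for each \<open>i \<notin> S\<close>. It is generated by the unit vectors \<open>e\<^sub>i\<close> for \<open>i \<in> S\<close>
  and the \<open>y\<^sub>j e\<^sub>i\<close> for \<open>i \<notin> S\<close>, and \<open>K\<close>, the inverse of \<open>J\<close>, carries these generators back.
\<close>

lemma log_submodule_finitely_generated:
  fixes J K :: "'n::finite \<Rightarrow> 'n \<Rightarrow> 'a"
  assumes I: "ideal I R"
    and J: "\<And>i j. J i j \<in> carrier R" and K: "\<And>i j. K i j \<in> carrier R"
    and JK: "\<And>i l. (\<Oplus>j\<in>UNIV. J i j \<otimes> K j l) = (if i = l then \<one> else \<zero>)"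
    and KJ: "\<And>i l. (\<Oplus>j\<in>UNIV. K i j \<otimes> J j l) = (if i = l then \<one> else \<zero>)"
    and y: "\<And>j::'n. y j \<in> I"
    and gen: "\<And>x. x \<in> I \<Longrightarrow> \<exists>b. (\<forall>j. b j \<in> carrier R) \<and> x = (\<Oplus>j\<in>UNIV. b j \<otimes> y j)"
  shows "\<exists>m \<eta>. (\<forall>j<m. \<forall>i. \<eta> j $ i \<in> carrier R) \<and> log_submodule R J S I = lin_span R m \<eta>"
proof -
  interpret I: ideal I R by (rule I)
  \<comment> \<open>All generators are indexed by pairs; for \<open>i \<in> S\<close> the second index is a mere repetition.\<close>
  define z where "z i j = (if i \<in> S then \<one> else y j)" for i j
  have z: "z i j \<in> carrier R" for i j using y I.Icarr by (simp add: z_def)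
  define G :: "'n \<times> 'n \<Rightarrow> 'a ^ 'n" where "G x = (\<chi> l. K l (fst x) \<otimes> z (fst x) (snd x))" for x
  have G: "G x $ l \<in> carrier R" for x l using K z by (simp add: G_def)
  obtain h where h: "bij_betw h {..<card (UNIV :: ('n \<times> 'n) set)} (UNIV :: ('n \<times> 'n) set)"
    using ex_bij_betw_nat_finite[of "UNIV :: ('n \<times> 'n) set"] by (auto simp: atLeast0LessThan)
  let ?m = "card (UNIV :: ('n \<times> 'n) set)"
  have sum_h: "(\<Oplus>x\<in>UNIV. f x) = (\<Oplus>j\<in>{..<?m}. f (h j))" if "\<And>x. f x \<in> carrier R" for f
  proof -
    have "(\<Oplus>x\<in>UNIV. f x) = (\<Oplus>x\<in>h ` {..<?m}. f x)"
      using h by (simp add: bij_betw_def)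
    also have "\<dots> = (\<Oplus>j\<in>{..<?m}. f (h j))"
      using h that by (intro finsum_reindex) (auto simp: bij_betw_def)
    finally show ?thesis .
  qed
  have "log_submodule R J S I = lin_span R ?m (\<lambda>j. G (h j))"
  proof (intro equalityI subsetI)
    fix v assume "v \<in> log_submodule R J S I"
    then have v: "\<And>i. v $ i \<in> carrier R" and vI: "\<And>i. i \<notin> S \<Longrightarrow> mat_vec R J v $ i \<in> I"
      by (auto simp: log_submodule_def)
    define \<theta> where "\<theta> = mat_vec R J v"
    have \<theta>: "\<theta> $ i \<in> carrier R" for i unfolding \<theta>_def using J v by (intro mat_vec_closed)
    have "\<exists>b. (\<forall>j. b j \<in> carrier R) \<and> \<theta> $ i = (\<Oplus>j\<in>UNIV. b j \<otimes> z i j)" for i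
    proof (cases "i \<in> S")
      case True
      have "(\<Oplus>j\<in>UNIV. (if j = i then \<theta> $ i else \<zero>) \<otimes> z i j) = (if i = i then \<theta> $ i else \<zero>) \<otimes> z i i"
        using \<theta> z by (intro finsum_single) auto
      then show ?thesis
        using \<theta> True by (intro exI[of _ "\<lambda>j. if j = i then \<theta> $ i else \<zero>"]) (auto simp: z_def)
    next
      case False
      then show ?thesis using gen[OF vI[OF False]] by (simp add: z_def \<theta>_def)
    qed
    then obtain b where b: "\<And>i j. b i j \<in> carrier R" and \<theta>b: "\<And>i. \<theta> $ i = (\<Oplus>j\<in>UNIV. b i j \<otimes> z i j)"
      by metis
    have "v $ l = (\<Oplus>j\<in>{..<?m}. b (fst (h j)) (snd (h j)) \<otimes> G (h j) $ l)" for l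
    proof -
      have "v = mat_vec R K \<theta>"
        unfolding \<theta>_def using J K v KJ by (intro mat_vec_inverse[symmetric]) auto
      then have "v $ l = (\<Oplus>i\<in>UNIV. K l i \<otimes> (\<Oplus>j\<in>UNIV. b i j \<otimes> z i j))"
        by (simp add: mat_vec_def \<theta>b)
      also have "\<dots> = (\<Oplus>i\<in>UNIV. \<Oplus>j\<in>UNIV. b i j \<otimes> G (i, j) $ l)"
        using K b z by (intro finsum_cong' refl)
          (auto simp: finsum_rdistr G_def m_lcomm intro!: finsum_closed)
      also have "\<dots> = (\<Oplus>x\<in>UNIV \<times> UNIV. b (fst x) (snd x) \<otimes> G (fst x, snd x) $ l)"
        using b G by (intro finsum_cartesian_product[symmetric]) auto
      also have "\<dots> = (\<Oplus>j\<in>{..<?m}. b (fst (h j)) (snd (h j)) \<otimes> G (h j) $ l)"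
        using b G by (simp add: sum_h)
      finally show ?thesis .
    qed
    then show "v \<in> lin_span R ?m (\<lambda>j. G (h j))"
      unfolding lin_span_def using b
      by (intro CollectI exI[of _ "\<lambda>j. b (fst (h j)) (snd (h j))"]) (auto simp: vec_eq_iff)
  next
    fix v assume "v \<in> lin_span R ?m (\<lambda>j. G (h j))"
    then obtain c where c: "\<And>j. j < ?m \<Longrightarrow> c j \<in> carrier R"
      and v': "v = (\<chi> l. \<Oplus>j\<in>{..<?m}. c j \<otimes> G (h j) $ l)"
      unfolding lin_span_def by blast
    have v: "v $ l = (\<Oplus>j\<in>{..<?m}. c j \<otimes> G (h j) $ l)" for l
      by (simp add: v')
    have Gh: "G (h j) $ l \<in> carrier R" for j l by (rule G)
    have JG: "mat_vec R J (G x) $ i \<in> I" if "i \<notin> S" for x i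
    proof -
      have "mat_vec R J (G x) $ i = (\<Oplus>l\<in>UNIV. J i l \<otimes> K l (fst x) \<otimes> z (fst x) (snd x))"
        unfolding mat_vec_def vec_lambda_beta G_def using J K z
        by (intro finsum_cong' refl) (auto simp: m_assoc)
      also have "\<dots> = (if i = fst x then \<one> else \<zero>) \<otimes> z (fst x) (snd x)"
        using J K z by (subst finsum_ldistr[symmetric]) (auto simp: JK)
      also have "\<dots> \<in> I" using that y z I.zero_closed I.Icarr by (auto simp: z_def)
      finally show ?thesis .
    qed
    have "mat_vec R J v $ i \<in> I" if "i \<notin> S" for i
    proof -
      have "mat_vec R J v $ i = (\<Oplus>l\<in>UNIV. \<Oplus>j\<in>{..<?m}. c j \<otimes> (J i l \<otimes> G (h j) $ l))"
        unfolding mat_vec_def vec_lambda_beta v using J Gh c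
        by (intro finsum_cong' refl) (auto simp: finsum_rdistr m_lcomm Pi_iff intro!: finsum_closed finsum_cong')
      also have "\<dots> = (\<Oplus>j\<in>{..<?m}. \<Oplus>l\<in>UNIV. c j \<otimes> (J i l \<otimes> G (h j) $ l))"
        using J Gh c by (intro finsum_swap) auto
      also have "\<dots> = (\<Oplus>j\<in>{..<?m}. c j \<otimes> mat_vec R J (G (h j)) $ i)"
        unfolding mat_vec_def vec_lambda_beta using J Gh c
        by (intro finsum_cong' refl) (auto simp: finsum_rdistr intro!: finsum_closed)
      also have "\<dots> \<in> I"
        using c by (intro ideal_finsum_closed[OF I] I.I_l_closed JG that) auto
      finally show ?thesis .
    qed
    moreover have "v $ l \<in> carrier R" for l
      unfolding v using c Gh by (intro finsum_closed) auto
    ultimately show "v \<in> log_submodule R J S I" by (simp add: log_submodule_def)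
  qed
  moreover have "\<forall>j<?m. \<forall>i. G (h j) $ i \<in> carrier R"
    using G by (intro allI impI)
  ultimately show ?thesis
    by (intro exI[of _ ?m] exI[of _ "\<lambda>j. G (h j)"] conjI)
qed

end

section \<open>Partial derivatives of holomorphic functions\<close>

text \<open>
  The partial derivative as it occurs in \<open>germ_pderiv\<close>: a complex derivative along a coordinate
  line. For a holomorphic function it is a coefficient of the Frechet derivative
  (\<open>holo_on_has_derivative\<close>).
\<close>

definition pd :: "'n \<Rightarrow> (complex ^ 'n \<Rightarrow> complex) \<Rightarrow> complex ^ 'n \<Rightarrow> complex" where
  "pd i f z = deriv (\<lambda>t. f (z + axis i t)) 0"

lemma bounded_linear_axis: "bounded_linear (axis i :: complex \<Rightarrow> complex ^ 'n)"
  unfolding linear_conv_bounded_linear[symmetric]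
  by (rule linearI) (auto simp: axis_def vec_eq_iff)

lemma norm_axis_le: "norm (axis i c :: complex ^ 'n) \<le> norm c"
proof -
  have "norm (axis i c :: complex ^ 'n) \<le> (\<Sum>j\<in>UNIV. norm ((axis i c :: complex ^ 'n) $ j))"
    unfolding norm_vec_def by (rule L2_set_le_sum) simp
  also have "\<dots> = (\<Sum>j\<in>UNIV. if j = i then norm c else 0)"
    by (rule sum.cong) (auto simp: axis_def)
  finally show ?thesis by simp
qed

lemma has_derivative_vecI:
  fixes F :: "'a::real_normed_vector \<Rightarrow> complex ^ 'n"
  assumes "\<And>i. ((\<lambda>z. F z $ i) has_derivative (\<lambda>v. D v $ i)) net"
  shows "(F has_derivative D) net"
proof -
  have sum_axis: "(\<Sum>i\<in>UNIV. axis i (x $ i)) = x" for x :: "complex ^ 'n"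
    by (simp add: vec_eq_iff axis_def if_distrib[of "\<lambda>g. g _"] cong: if_cong)
  have "((\<lambda>z. \<Sum>i\<in>UNIV. axis i (F z $ i)) has_derivative (\<lambda>v. \<Sum>i\<in>UNIV. axis i (D v $ i))) net"
    by (intro has_derivative_sum bounded_linear.has_derivative[OF bounded_linear_axis] assms)
  then show ?thesis by (simp add: sum_axis)
qed

lemma pd_eqI:
  fixes f :: "complex ^ 'n \<Rightarrow> complex"
  assumes "(f has_derivative D) (at z)" "\<And>c v. D (c *s v) = c * D v"
  shows "pd i f z = D (axis i 1)"
proof -
  have "((\<lambda>t. z + axis i t) has_derivative (\<lambda>t. 0 + axis i t)) (at 0)"
    by (intro has_derivative_add has_derivative_const bounded_linear.has_derivative[OF bounded_linear_axis]
          has_derivative_ident)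
  then have "((\<lambda>t. f (z + axis i t)) has_derivative (\<lambda>t. D (0 + axis i t))) (at 0)"
  proof (rule has_derivative_compose)
    have "z + axis i 0 = z" by (simp add: vec_eq_iff axis_def)
    then show "(f has_derivative D) (at (z + axis i 0))" using assms(1) by (simp only:)
  qed
  moreover have "(\<lambda>t. D (0 + axis i t)) = (*) (D (axis i 1))"
  proof
    fix t
    have "0 + axis i t = t *s (axis i 1 :: complex ^ 'n)" by (simp add: vec_eq_iff axis_def)
    then show "D (0 + axis i t) = D (axis i 1) * t" by (simp only: assms(2) mult.commute)
  qed
  ultimately have "((\<lambda>t. f (z + axis i t)) has_field_derivative D (axis i 1)) (at 0)"
    by (simp only: has_field_derivative_def)
  then show ?thesis unfolding pd_def by (rule DERIV_imp_deriv)
qed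

lemma holo_on_has_derivative:
  assumes "holo_on U f" "z \<in> U"
  shows "(f has_derivative (\<lambda>v. \<Sum>i\<in>UNIV. v $ i * pd i f z)) (at z)"
proof -
  obtain D where D: "(f has_derivative D) (at z)" "\<And>c v. D (c *s v) = c * D v"
    using assms unfolding holo_on_def by blast
  have "D v = (\<Sum>i\<in>UNIV. v $ i * pd i f z)" for v
  proof -
    have "D v = D (\<Sum>i\<in>UNIV. v $ i *s axis i 1)" by (simp add: basis_expansion)
    also have "\<dots> = (\<Sum>i\<in>UNIV. D (v $ i *s axis i 1))"
      using has_derivative_linear[OF D(1)] by (rule linear_sum)
    finally show ?thesis by (simp add: D(2) pd_eqI[OF D])
  qed
  then have "D = (\<lambda>v. \<Sum>i\<in>UNIV. v $ i * pd i f z)" by (rule ext)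
  then show ?thesis using D(1) by simp
qed

text \<open>
  Derivatives are kept in the form of a coordinate sum: the coefficients then give both complex
  linearity and, by \<open>pd_unique\<close>, the partial derivatives.
\<close>

lemma holo_onI:
  assumes "\<And>z. z \<in> U \<Longrightarrow> (f has_derivative (\<lambda>v. \<Sum>i\<in>UNIV. v $ i * P i z)) (at z)"
  shows "holo_on U f"
  unfolding holo_on_def
proof
  fix z assume "z \<in> U"
  then show "\<exists>D. (f has_derivative D) (at z) \<and> (\<forall>c v. D (c *s v) = c * D v)"
    using assms by (intro exI[of _ "\<lambda>v. \<Sum>i\<in>UNIV. v $ i * P i z"])
      (auto simp: sum_distrib_left mult.assoc)
qed

lemma pd_unique:
  assumes "(f has_derivative (\<lambda>v. \<Sum>i\<in>UNIV. v $ i * P i)) (at z)"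
  shows "pd i f z = P i"
proof -
  have "pd i f z = (\<Sum>j\<in>UNIV. axis i 1 $ j * P j)"
    using assms by (rule pd_eqI) (simp add: sum_distrib_left mult.assoc)
  also have "\<dots> = (\<Sum>j\<in>UNIV. if j = i then P j else 0)"
    by (rule sum.cong) (auto simp: axis_def)
  finally show ?thesis by simp
qed

lemma holo_on_subset: "holo_on U f \<Longrightarrow> V \<subseteq> U \<Longrightarrow> holo_on V f"
  by (auto simp: holo_on_def)

lemma holo_on_cong:
  assumes "open U" "holo_on U f" "\<And>z. z \<in> U \<Longrightarrow> f z = g z"
  shows "holo_on U g"
  unfolding holo_on_def
proof
  fix z assume z: "z \<in> U"
  obtain D where "(f has_derivative D) (at z)" "\<forall>c v. D (c *s v) = c * D v"
    using assms(2) z unfolding holo_on_def by blast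
  moreover from this(1) have "(g has_derivative D) (at z)"
    using assms(1) z by (rule has_derivative_transform_within_open) (rule assms(3))
  ultimately show "\<exists>D. (g has_derivative D) (at z) \<and> (\<forall>c v. D (c *s v) = c * D v)" by blast
qed

lemma holo_on_if_locally: "(\<And>z. z \<in> U \<Longrightarrow> \<exists>V. z \<in> V \<and> holo_on V f) \<Longrightarrow> holo_on U f"
  unfolding holo_on_def by blast

lemma holo_on_imp_continuous_on: "holo_on U f \<Longrightarrow> continuous_on U f"
  by (meson continuous_at_imp_continuous_on has_derivative_continuous holo_on_has_derivative)

lemma holo_on_const: "holo_on U (\<lambda>z. c)"
  by (rule holo_onI[of _ _ "\<lambda>_ _. 0"]) simp

lemma has_derivative_add_pd:
  assumes "holo_on U f" "holo_on U g" "z \<in> U"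
  shows "((\<lambda>z. f z + g z) has_derivative (\<lambda>v. \<Sum>i\<in>UNIV. v $ i * (pd i f z + pd i g z))) (at z)"
  using has_derivative_add[OF holo_on_has_derivative[OF assms(1,3)] holo_on_has_derivative[OF assms(2,3)]]
  by (simp add: sum.distrib distrib_left)

lemma has_derivative_mult_pd:
  assumes "holo_on U f" "holo_on U g" "z \<in> U"
  shows "((\<lambda>z. f z * g z) has_derivative
    (\<lambda>v. \<Sum>i\<in>UNIV. v $ i * (f z * pd i g z + pd i f z * g z))) (at z)"
  using has_derivative_mult[OF holo_on_has_derivative[OF assms(1,3)] holo_on_has_derivative[OF assms(2,3)]]
  by (simp add: sum.distrib sum_distrib_left sum_distrib_right distrib_left mult_ac)

lemma holo_on_add: "holo_on U f \<Longrightarrow> holo_on U g \<Longrightarrow> holo_on U (\<lambda>z. f z + g z)"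
  by (rule holo_onI) (rule has_derivative_add_pd)

lemma holo_on_mult: "holo_on U f \<Longrightarrow> holo_on U g \<Longrightarrow> holo_on U (\<lambda>z. f z * g z)"
  by (rule holo_onI) (rule has_derivative_mult_pd)

lemma has_derivative_compose_pd:
  assumes "holo_map_on U \<phi>" "\<phi> ` U \<subseteq> V" "holo_on V g" "z \<in> U"
  shows "((\<lambda>z. g (\<phi> z)) has_derivative
    (\<lambda>v. \<Sum>j\<in>UNIV. v $ j * (\<Sum>i\<in>UNIV. pd i g (\<phi> z) * pd j (\<lambda>z. \<phi> z $ i) z))) (at z)"
proof -
  have "(\<phi> has_derivative (\<lambda>v. \<chi> i. \<Sum>j\<in>UNIV. v $ j * pd j (\<lambda>z. \<phi> z $ i) z)) (at z)"
    using assms(1,4) by (intro has_derivative_vecI) (auto simp: holo_map_on_def intro!: holo_on_has_derivative)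
  moreover have "(g has_derivative (\<lambda>v. \<Sum>i\<in>UNIV. v $ i * pd i g (\<phi> z))) (at (\<phi> z))"
    using assms by (intro holo_on_has_derivative[of V]) auto
  ultimately have "((\<lambda>z. g (\<phi> z)) has_derivative
      (\<lambda>v. \<Sum>i\<in>UNIV. (\<chi> i. \<Sum>j\<in>UNIV. v $ j * pd j (\<lambda>z. \<phi> z $ i) z) $ i * pd i g (\<phi> z))) (at z)"
    by (rule has_derivative_compose)
  moreover have "(\<Sum>i\<in>UNIV. (\<chi> i. \<Sum>j\<in>UNIV. v $ j * pd j (\<lambda>z. \<phi> z $ i) z) $ i * pd i g (\<phi> z)) =
      (\<Sum>j\<in>UNIV. v $ j * (\<Sum>i\<in>UNIV. pd i g (\<phi> z) * pd j (\<lambda>z. \<phi> z $ i) z))" for v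
    by (simp add: sum_distrib_left sum_distrib_right mult_ac) (rule sum.swap)
  ultimately show ?thesis by simp
qed

lemma holo_on_compose:
  "holo_map_on U \<phi> \<Longrightarrow> \<phi> ` U \<subseteq> V \<Longrightarrow> holo_on V g \<Longrightarrow> holo_on U (\<lambda>z. g (\<phi> z))"
  by (rule holo_onI) (rule has_derivative_compose_pd)

lemma pd_compose:
  assumes "holo_map_on U \<phi>" "\<phi> ` U \<subseteq> V" "holo_on V g" "z \<in> U"
  shows "pd j (\<lambda>z. g (\<phi> z)) z = (\<Sum>i\<in>UNIV. pd i g (\<phi> z) * pd j (\<lambda>z. \<phi> z $ i) z)"
  by (rule pd_unique) (rule has_derivative_compose_pd[OF assms])

text \<open>
  Differentiation under the integral sign: the derivative is an integral of complex linear maps.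
\<close>

lemma holo_on_integral:
  fixes h :: "complex ^ 'n \<Rightarrow> real \<Rightarrow> complex"
  assumes "open U" "convex U"
    and der: "\<And>z t. z \<in> U \<Longrightarrow> t \<in> {a..b} \<Longrightarrow>
      ((\<lambda>z. h z t) has_derivative (\<lambda>v. \<Sum>i\<in>UNIV. v $ i * P i z t)) (at z)"
    and conth: "\<And>z. z \<in> U \<Longrightarrow> continuous_on {a..b} (h z)"
    and contP: "\<And>i. continuous_on (U \<times> {a..b}) (\<lambda>(z, t). P i z t)"
  shows "holo_on U (\<lambda>z. integral {a..b} (h z))"
  unfolding holo_on_def
proof
  fix z0 assume z0: "z0 \<in> U"
  define fx where "fx z t = Blinfun (\<lambda>v. \<Sum>i\<in>UNIV. v $ i * P i z t)" for z t
  have fx: "blinfun_apply (fx z t) = (\<lambda>v. \<Sum>i\<in>UNIV. v $ i * P i z t)" for z t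
    unfolding fx_def
    by (intro bounded_linear_Blinfun_apply bounded_linear_sum bounded_linear_mult_const bounded_linear_vec_nth)
  have cont_fx: "continuous_on (U \<times> {a..b}) (\<lambda>(z, t). fx z t)"
  proof (rule continuous_on_blinfun_componentwise)
    fix v :: "complex ^ 'n"
    have "continuous_on (U \<times> {a..b}) (\<lambda>x. \<Sum>i\<in>UNIV. v $ i * (\<lambda>(z, t). P i z t) x)"
      by (intro continuous_intros contP)
    then show "continuous_on (U \<times> {a..b}) (\<lambda>x. blinfun_apply (case x of (z, t) \<Rightarrow> fx z t) v)"
      by (simp add: fx case_prod_beta)
  qed
  have "((\<lambda>z. integral (cbox a b) (h z)) has_derivative integral (cbox a b) (fx z0)) (at z0 within U)"
  proof (rule leibniz_rule[OF _ _ _ z0 assms(2)])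
    show "((\<lambda>z. h z t) has_derivative blinfun_apply (fx z t)) (at z within U)"
      if "z \<in> U" "t \<in> cbox a b" for z t
      using der[OF that(1)] that(2) by (simp add: fx has_derivative_at_withinI)
    show "h z integrable_on cbox a b" if "z \<in> U" for z
      using conth[OF that] by (intro integrable_continuous) simp
  qed (use cont_fx in simp)
  then have D: "((\<lambda>z. integral {a..b} (h z)) has_derivative integral {a..b} (fx z0)) (at z0)"
    using at_within_open[OF z0 \<open>open U\<close>] by simp
  have "fx z0 integrable_on {a..b}"
  proof (rule integrable_continuous_real)
    have "continuous_on {a..b} (\<lambda>t. (\<lambda>(z, t). fx z t) (z0, t))"
      by (rule continuous_on_compose2[OF cont_fx]) (use z0 in \<open>auto intro!: continuous_intros\<close>)
    then show "continuous_on {a..b} (fx z0)" by simp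
  qed
  then have app: "integral {a..b} (fx z0) v = integral {a..b} (\<lambda>t. fx z0 t v)" for v
    by (rule blinfun_apply_integral)
  have "integral {a..b} (fx z0) (c *s v) = c * integral {a..b} (fx z0) v" for c v
  proof -
    have "integral {a..b} (fx z0) (c *s v) = integral {a..b} (\<lambda>t. c * fx z0 t v)"
      unfolding app by (simp add: fx sum_distrib_left mult.assoc)
    then show ?thesis by (simp add: app)
  qed
  with D show "\<exists>D. ((\<lambda>z. integral {a..b} (h z)) has_derivative D) (at z0) \<and> (\<forall>c v. D (c *s v) = c * D v)"
    by blast
qed

text \<open>
  Cauchy's formula for the derivative, on a circle in the direction of the \<open>i\<close>-th axis. On the
  right-hand side \<open>z\<close> enters only through \<open>f\<close>, which permits differentiation in \<open>z\<close>.
\<close>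

lemma pd_eq_integral:
  assumes f: "holo_on U f" and r: "r > 0" and U: "\<And>\<zeta>. norm \<zeta> \<le> r \<Longrightarrow> z + axis i \<zeta> \<in> U"
  shows "pd i f z = integral {0..2 * pi} (\<lambda>t. f (z + axis i (r * cis t)) * (1 / (2 * pi * r * cis t)))"
proof -
  define g where "g \<zeta> = f (z + axis i \<zeta>)" for \<zeta>
  have der: "(g has_field_derivative pd i f (z + axis i \<zeta>)) (at \<zeta>)" if "norm \<zeta> \<le> r" for \<zeta>
  proof -
    have "((\<lambda>t. z + axis i t) has_derivative (\<lambda>t. 0 + axis i t)) (at \<zeta>)"
      by (intro has_derivative_add has_derivative_const bounded_linear.has_derivative[OF bounded_linear_axis]
            has_derivative_ident)
    then have "((\<lambda>t. f (z + axis i t)) has_derivative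
        (\<lambda>t. \<Sum>j\<in>UNIV. (0 + axis i t) $ j * pd j f (z + axis i \<zeta>))) (at \<zeta>)"
      by (rule has_derivative_compose) (rule holo_on_has_derivative[OF f U[OF that]])
    moreover have "(\<Sum>j\<in>UNIV. (0 + axis i t) $ j * pd j f (z + axis i \<zeta>)) = pd i f (z + axis i \<zeta>) * t" for t
    proof -
      have "(\<Sum>j\<in>UNIV. (0 + axis i t) $ j * pd j f (z + axis i \<zeta>)) =
          (\<Sum>j\<in>UNIV. if j = i then t * pd j f (z + axis i \<zeta>) else 0)"
        by (rule sum.cong) (auto simp: axis_def)
      then show ?thesis by (simp add: mult.commute)
    qed
    ultimately show ?thesis by (simp add: has_field_derivative_def g_def[abs_def])
  qed
  have "continuous_on (cball 0 r) g"
    by (intro continuous_at_imp_continuous_on ballI DERIV_isCont[OF der]) simp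
  moreover have "g holomorphic_on ball 0 r"
  proof (rule holomorphic_on_open[THEN iffD2, OF open_ball], rule ballI)
    fix \<zeta> :: complex assume "\<zeta> \<in> ball 0 r"
    then have "norm \<zeta> \<le> r" by simp
    from der[OF this] show "\<exists>g'. (g has_field_derivative g') (at \<zeta>)" by (rule exI)
  qed
  moreover have "(0::complex) \<in> ball 0 r" using r by simp
  ultimately have int: "(\<lambda>u. g u / (u - 0)\<^sup>2) contour_integrable_on circlepath 0 r"
    and "(g has_field_derivative 1 / (2 * of_real pi * \<i>) *
      contour_integral (circlepath 0 r) (\<lambda>u. g u / (u - 0)\<^sup>2)) (at 0)"
    by (rule Cauchy_derivative_integral_circlepath)+
  then have "deriv g 0 = 1 / (2 * of_real pi * \<i>) * contour_integral (circlepath 0 r) (\<lambda>u. g u / (u - 0)\<^sup>2)"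
    by (intro DERIV_imp_deriv)
  moreover have "deriv g 0 = pd i f z" by (simp add: g_def[abs_def] pd_def)
  ultimately have pd: "pd i f z =
      1 / (2 * of_real pi * \<i>) * contour_integral (circlepath 0 r) (\<lambda>u. g u / (u - 0)\<^sup>2)"
    by (simp only:)
  have "((\<lambda>t. g (0 + r * cis t) / (0 + r * cis t - 0)\<^sup>2 * r * \<i> * cis t) has_integral
      contour_integral (circlepath 0 r) (\<lambda>u. g u / (u - 0)\<^sup>2)) {0..2 * pi}"
    using has_contour_integral_integral[OF int] unfolding circlepath_def
    by (subst (asm) has_contour_integral_part_circlepath_iff) simp_all
  then have "((\<lambda>t. 1 / (2 * of_real pi * \<i>) * (g (0 + r * cis t) / (0 + r * cis t - 0)\<^sup>2 * r * \<i> * cis t))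
      has_integral pd i f z) {0..2 * pi}"
    unfolding pd by (rule has_integral_mult_right)
  also have "(\<lambda>t. 1 / (2 * of_real pi * \<i>) * (g (0 + r * cis t) / (0 + r * cis t - 0)\<^sup>2 * r * \<i> * cis t)) =
      (\<lambda>t. f (z + axis i (r * cis t)) * (1 / (2 * pi * r * cis t)))"
    using r by (intro ext) (simp add: g_def field_simps power2_eq_square)
  finally show ?thesis by (rule integral_unique[symmetric])
qed

text \<open>
  With half of the admissible radius for \<open>z\<close> and half for the circle, the circles around all points of
  a ball stay inside \<open>U\<close>.
\<close>

lemma polydisc_in_ball:
  assumes "z \<in> ball z0 r" "norm \<zeta> \<le> r" "cball z0 (2 * r) \<subseteq> U"
  shows "z + axis i \<zeta> \<in> (U :: (complex ^ 'n) set)"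
proof -
  have axis: "norm (axis i \<zeta> :: complex ^ 'n) \<le> norm \<zeta>" by (rule norm_axis_le)
  have "norm (z + axis i \<zeta> - z0) \<le> norm (z - z0) + norm (axis i \<zeta> :: complex ^ 'n)"
    using norm_triangle_ineq[of "z - z0" "axis i \<zeta>"] by (simp add: algebra_simps)
  also have "\<dots> \<le> r + r"
    using assms(1,2) axis by (intro add_mono) (auto simp: dist_norm norm_minus_commute)
  finally show ?thesis
    using assms(3) by (auto simp: subset_iff dist_norm norm_minus_commute)
qed

lemma cball_double_subset:
  assumes "open U" "z0 \<in> U"
  obtains r where "r > 0" "cball z0 (2 * r) \<subseteq> U"
proof -
  obtain e where "e > 0" "cball z0 e \<subseteq> U"
    using assms open_contains_cball by blast
  then show ?thesis by (intro that[of "e / 2"]) auto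
qed

lemma continuous_on_cauchy_kernel:
  fixes F :: "complex ^ 'n \<Rightarrow> complex"
  assumes "continuous_on U F" "r > 0" "cball z0 (2 * r) \<subseteq> U"
  shows "continuous_on (ball z0 r \<times> {0..2 * pi})
    (\<lambda>(z, t). F (z + axis i (r * cis t)) * (1 / (2 * pi * r * cis t)))"
  unfolding case_prod_beta
proof (intro continuous_on_mult)
  show "continuous_on (ball z0 r \<times> {0..2 * pi}) (\<lambda>x. F (fst x + axis i (r * cis (snd x))))"
  proof (rule continuous_on_compose2[OF assms(1)])
    show "continuous_on (ball z0 r \<times> {0..2 * pi}) (\<lambda>x. fst x + axis i (r * cis (snd x)))"
      by (intro continuous_intros bounded_linear.continuous_on[OF bounded_linear_axis])
    show "(\<lambda>x. fst x + axis i (r * cis (snd x))) ` (ball z0 r \<times> {0..2 * pi}) \<subseteq> U"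
      using assms(2,3) by (auto intro!: polydisc_in_ball simp: norm_mult)
  qed
qed (use assms(2) in \<open>intro continuous_intros; simp\<close>)

lemma continuous_on_pd:
  assumes "open U" "holo_on U f"
  shows "continuous_on U (pd i f)"
proof (rule continuous_at_imp_continuous_on, rule ballI)
  fix z0 assume "z0 \<in> U"
  then obtain r where r: "r > 0" "cball z0 (2 * r) \<subseteq> U"
    using cball_double_subset[OF assms(1)] by blast
  have "continuous_on (ball z0 r)
      (\<lambda>z. integral (cbox 0 (2 * pi)) (\<lambda>t. f (z + axis i (r * cis t)) * (1 / (2 * pi * r * cis t))))"
    using continuous_on_cauchy_kernel[OF holo_on_imp_continuous_on[OF assms(2)] r]
    by (intro integral_continuous_on_param) simp
  moreover have "integral (cbox 0 (2 * pi)) (\<lambda>t. f (z + axis i (r * cis t)) * (1 / (2 * pi * r * cis t))) = pd i f z"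
    if "z \<in> ball z0 r" for z
    using pd_eq_integral[OF assms(2) r(1) polydisc_in_ball[OF that _ r(2)]] by simp
  ultimately have "continuous_on (ball z0 r) (pd i f)"
    by (rule continuous_on_eq)
  then show "isCont (pd i f) z0"
    using r(1) by (simp add: continuous_on_eq_continuous_at)
qed

text \<open>
  Frechet differentiability on an open set suffices, because Cauchy's formula in the single
  variable \<open>z\<^sub>i\<close> writes the partial derivative as an integral that may be differentiated in \<open>z\<close>;
  the integrand is \<open>C\<^sup>1\<close> by the previous lemma, which uses the same formula.
\<close>

lemma holo_on_pd:
  assumes "open U" "holo_on U f"
  shows "holo_on U (pd i f)"
proof -
  have "holo_on (ball z0 r) (pd i f)" if r: "r > 0" "cball z0 (2 * r) \<subseteq> U" for z0 r
  proof -
    let ?k = "\<lambda>t. 1 / (2 * pi * r * cis t)"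
    let ?h = "\<lambda>z t. f (z + axis i (r * cis t)) * ?k t"
    have "holo_on (ball z0 r) (\<lambda>z. integral {0..2 * pi} (?h z))"
    proof (rule holo_on_integral[where P = "\<lambda>j z t. pd j f (z + axis i (r * cis t)) * ?k t"])
      fix z t assume z: "z \<in> ball z0 r"
      have in_U: "z + axis i (r * cis t) \<in> U"
        using z r by (intro polydisc_in_ball) (auto simp: norm_mult)
      have "((\<lambda>z. z + axis i (r * cis t)) has_derivative (\<lambda>v. v + 0)) (at z)"
        by (intro has_derivative_add has_derivative_ident has_derivative_const)
      then have "((\<lambda>z. f (z + axis i (r * cis t))) has_derivative
          (\<lambda>v. \<Sum>j\<in>UNIV. (v + 0) $ j * pd j f (z + axis i (r * cis t)))) (at z)"
        by (rule has_derivative_compose) (rule holo_on_has_derivative[OF assms(2) in_U])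
      from has_derivative_mult_left[OF this, of "?k t"]
      show "((\<lambda>z. ?h z t) has_derivative
          (\<lambda>v. \<Sum>j\<in>UNIV. v $ j * (pd j f (z + axis i (r * cis t)) * ?k t))) (at z)"
        by (simp add: sum_distrib_right sum_divide_distrib mult.assoc)
    next
      fix z assume z: "z \<in> ball z0 r"
      have "continuous_on {0..2 * pi} (\<lambda>t. (\<lambda>(z, t). ?h z t) (z, t))"
        by (rule continuous_on_compose2[OF continuous_on_cauchy_kernel[OF holo_on_imp_continuous_on[OF assms(2)] r]])
          (use z in \<open>auto intro!: continuous_intros\<close>)
      then show "continuous_on {0..2 * pi} (?h z)" by simp
    next
      show "continuous_on (ball z0 r \<times> {0..2 * pi}) (\<lambda>(z, t). pd j f (z + axis i (r * cis t)) * ?k t)" for j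
        by (rule continuous_on_cauchy_kernel[OF continuous_on_pd[OF assms] r])
    qed auto
    moreover have "integral {0..2 * pi} (?h z) = pd i f z" if "z \<in> ball z0 r" for z
      using pd_eq_integral[OF assms(2) r(1) polydisc_in_ball[OF that _ r(2)]] by simp
    ultimately show ?thesis by (rule holo_on_cong[OF open_ball])
  qed
  note on_balls = this
  show ?thesis
  proof (rule holo_on_if_locally)
    fix z assume "z \<in> U"
    then obtain r where r: "r > 0" "cball z (2 * r) \<subseteq> U"
      using cball_double_subset[OF assms(1)] by blast
    then show "\<exists>V. z \<in> V \<and> holo_on V (pd i f)"
      using on_balls[OF r] by (intro exI[of _ "ball z r"]) simp
  qed
qed


text \<open>
  Integrate the derivative of \<open>F\<close> along the segment from the projection of \<open>w\<close> to the subspace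
  (where \<open>F\<close> vanishes) to \<open>w\<close>.
\<close>

lemma hadamard_division:
  fixes F :: "complex ^ 'n \<Rightarrow> complex"
  assumes F: "holo_on (ball q r) F"
    and q: "\<And>i. i \<notin> S \<Longrightarrow> q $ i = 0"
    and zero: "\<And>w. w \<in> ball q r \<Longrightarrow> (\<And>i. i \<notin> S \<Longrightarrow> w $ i = 0) \<Longrightarrow> F w = 0"
  shows "\<exists>g. (\<forall>i. holo_on (ball q r) (g i)) \<and>
    (\<forall>w\<in>ball q r. F w = (\<Sum>i\<in>- S. w $ i * g i w))"
proof -
  \<comment> \<open>\<open>m t w\<close> runs from the projection of \<open>w\<close> (at \<open>t = 0\<close>) to \<open>w\<close> (at \<open>t = 1\<close>). It stays in the ball
    because the centre \<open>q\<close> lies in the subspace.\<close>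
  define s where "s j t = (if j \<in> S then 1 else of_real t :: complex)" for j :: 'n and t :: real
  define m where "m t w = (\<chi> j. s j t * w $ j)" for t and w :: "complex ^ 'n"
  have m_ball: "m t w \<in> ball q r" if "w \<in> ball q r" "t \<in> {0..1}" for t w
  proof -
    have "norm (m t w - q) \<le> norm (w - q)"
    proof (rule norm_le_componentwise_cart)
      fix j
      have "norm (s j t) \<le> 1" using that(2) by (simp add: s_def)
      moreover have "(m t w - q) $ j = s j t * (w - q) $ j"
        using q[of j] by (simp add: m_def s_def)
      ultimately show "norm ((m t w - q) $ j) \<le> norm ((w - q) $ j)"
        by (simp add: norm_mult mult_left_le_one_le)
    qed
    then show ?thesis using that(1) by (simp add: dist_norm norm_minus_commute)
  qed
  have cont_s: "continuous_on A (\<lambda>t. s j t)" for A j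
    unfolding s_def by (cases "j \<in> S") (auto intro!: continuous_intros)
  have cont_m: "continuous_on A (\<lambda>x. m (snd x) (fst x))" for A
    unfolding m_def
    by (intro continuous_intros continuous_on_compose2[OF cont_s[of UNIV]] subset_UNIV)
  have cont_F: "continuous_on (ball q r \<times> {0..1}) (\<lambda>x. H (m (snd x) (fst x)))"
    if "continuous_on (ball q r) H" for H :: "complex ^ 'n \<Rightarrow> complex"
    by (rule continuous_on_compose2[OF that cont_m]) (auto intro!: m_ball)
  have cont_F': "continuous_on {0..1} (\<lambda>t. H (m t w))"
    if "continuous_on (ball q r) H" "w \<in> ball q r" for H :: "complex ^ 'n \<Rightarrow> complex" and w
  proof -
    have "continuous_on {0..1} (\<lambda>t. H (m (snd (w, t)) (fst (w, t))))"
      by (rule continuous_on_compose2[OF cont_F[OF that(1)]])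
        (use that(2) in \<open>auto intro!: continuous_intros\<close>)
    then show ?thesis by simp
  qed
  define g where "g i w = integral {0..1} (\<lambda>t. pd i F (m t w))" for i w
  have "holo_on (ball q r) (g i)" for i
    unfolding g_def
  proof (rule holo_on_integral[where P = "\<lambda>j w t. pd j (pd i F) (m t w) * s j t"])
    fix w t assume w: "w \<in> ball q r" "t \<in> {0..1::real}"
    have "(m t has_derivative m t) (at w)"
    proof (rule has_derivative_vecI)
      fix j
      have "((\<lambda>w. s j t * w $ j) has_derivative (\<lambda>v. s j t * v $ j)) (at w)"
        by (intro has_derivative_mult_right bounded_linear.has_derivative[OF bounded_linear_vec_nth]
              has_derivative_ident)
      then show "((\<lambda>w. m t w $ j) has_derivative (\<lambda>v. m t v $ j)) (at w)"
        by (simp add: m_def)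
    qed
    then have "((\<lambda>w. pd i F (m t w)) has_derivative (\<lambda>v. \<Sum>j\<in>UNIV. m t v $ j * pd j (pd i F) (m t w))) (at w)"
      by (rule has_derivative_compose)
        (rule holo_on_has_derivative[OF holo_on_pd[OF open_ball F] m_ball[OF w]])
    then show "((\<lambda>w. pd i F (m t w)) has_derivative (\<lambda>v. \<Sum>j\<in>UNIV. v $ j * (pd j (pd i F) (m t w) * s j t))) (at w)"
      by (simp add: m_def mult_ac)
  next
    show "continuous_on {0..1} (\<lambda>t. pd i F (m t w))" if "w \<in> ball q r" for w
      using cont_F'[OF continuous_on_pd[OF open_ball F] that] .
    show "continuous_on (ball q r \<times> {0..1}) (\<lambda>(w, t). pd j (pd i F) (m t w) * s j t)" for j
      unfolding case_prod_beta
      by (intro continuous_on_mult cont_F continuous_on_pd[OF open_ball holo_on_pd[OF open_ball F]]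
            continuous_on_compose2[OF cont_s[of UNIV]] continuous_on_snd continuous_on_id subset_UNIV)
  qed auto
  moreover have "F w = (\<Sum>i\<in>- S. w $ i * g i w)" if w: "w \<in> ball q r" for w
  proof -
    have "((\<lambda>t. \<Sum>i\<in>- S. w $ i * pd i F (m t w)) has_integral (F (m 1 w) - F (m 0 w))) {0..1}"
    proof (rule fundamental_theorem_of_calculus)
      fix t :: real assume t: "t \<in> {0..1}"
      have "((\<lambda>t. m t w) has_derivative (\<lambda>h. \<chi> j. if j \<in> S then 0 else of_real h * w $ j)) (at t within {0..1})"
      proof (rule has_derivative_vecI)
        fix j
        show "((\<lambda>t. m t w $ j) has_derivative (\<lambda>h. (\<chi> j. if j \<in> S then 0 else of_real h * w $ j) $ j))
            (at t within {0..1})"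
          by (cases "j \<in> S")
            (auto simp: m_def s_def intro!: has_derivative_mult_left has_derivative_of_real has_derivative_ident)
      qed
      then have "((\<lambda>t. F (m t w)) has_derivative
          (\<lambda>h. \<Sum>i\<in>UNIV. (\<chi> j. if j \<in> S then 0 else of_real h * w $ j) $ i * pd i F (m t w))) (at t within {0..1})"
        by (rule has_derivative_compose) (rule holo_on_has_derivative[OF F m_ball[OF w t]])
      moreover have "(\<Sum>i\<in>UNIV. (\<chi> j. if j \<in> S then 0 else of_real h * w $ j) $ i * pd i F (m t w)) =
          h *\<^sub>R (\<Sum>i\<in>- S. w $ i * pd i F (m t w))" for h
      proof -
        have "(\<Sum>i\<in>UNIV. (\<chi> j. if j \<in> S then 0 else of_real h * w $ j) $ i * pd i F (m t w)) =
            (\<Sum>i\<in>- S. of_real h * (w $ i * pd i F (m t w)))"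
          by (rule sum.mono_neutral_cong_right) auto
        then show ?thesis by (simp add: sum_distrib_left scaleR_conv_of_real)
      qed
      ultimately show "((\<lambda>t. F (m t w)) has_vector_derivative (\<Sum>i\<in>- S. w $ i * pd i F (m t w))) (at t within {0..1})"
        by (simp add: has_vector_derivative_def)
    qed simp
    then have "F (m 1 w) - F (m 0 w) = integral {0..1} (\<lambda>t. \<Sum>i\<in>- S. w $ i * pd i F (m t w))"
      by (simp add: integral_unique)
    also have "\<dots> = (\<Sum>i\<in>- S. integral {0..1} (\<lambda>t. w $ i * pd i F (m t w)))"
      using cont_F'[OF continuous_on_pd[OF open_ball F] w]
      by (intro integral_sum integrable_continuous_real continuous_intros) auto
    also have "\<dots> = (\<Sum>i\<in>- S. w $ i * g i w)"
      by (simp add: g_def)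
    finally have "F (m 1 w) - F (m 0 w) = (\<Sum>i\<in>- S. w $ i * g i w)" .
    moreover have "m 1 w = w" by (simp add: m_def s_def vec_eq_iff)
    moreover have "F (m 0 w) = 0"
      using w by (intro zero m_ball) (auto simp: m_def s_def)
    ultimately show ?thesis by simp
  qed
  ultimately show ?thesis by blast
qed

section \<open>The ring of germs\<close>

lemma (in cring) ideal_if_closed:
  assumes "I \<subseteq> carrier R" "\<zero> \<in> I" "\<And>x y. x \<in> I \<Longrightarrow> y \<in> I \<Longrightarrow> x \<oplus> y \<in> I"
    and mult: "\<And>a x. a \<in> carrier R \<Longrightarrow> x \<in> I \<Longrightarrow> a \<otimes> x \<in> I"
  shows "ideal I R"
proof (rule idealI[OF ring_axioms])
  show "subgroup I (add_monoid R)"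
  proof (rule add.subgroupI)
    fix x assume "x \<in> I"
    then have "\<ominus> x = (\<ominus> \<one>) \<otimes> x" using assms(1) by (auto simp: l_minus)
    then show "\<ominus> x \<in> I" using mult[OF _ \<open>x \<in> I\<close>, of "\<ominus> \<one>"] by simp
  qed (use assms in auto)
  show "x \<otimes> a \<in> I" if "a \<in> I" "x \<in> carrier R" for a x using mult that by blast
  show "a \<otimes> x \<in> I" if "a \<in> I" "x \<in> carrier R" for a x
    using mult[OF that(2,1)] that assms(1) by (auto simp: m_comm)
qed

lemma holo_near_const: "holo_near p (\<lambda>z. c)"
  unfolding holo_near_def using holo_on_const open_UNIV by blast

lemma holo_nearI: "open U \<Longrightarrow> p \<in> U \<Longrightarrow> holo_on U f \<Longrightarrow> holo_near p f"
  unfolding holo_near_def by blast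

lemma holo_near_common:
  assumes "holo_near p f" "holo_near p g"
  obtains U where "open U" "p \<in> U" "holo_on U f" "holo_on U g"
proof -
  obtain U V where "open U" "p \<in> U" "holo_on U f" "open V" "p \<in> V" "holo_on V g"
    using assms unfolding holo_near_def by blast
  then show ?thesis by (intro that[of "U \<inter> V"]) (auto intro: holo_on_subset)
qed

lemma holo_near_add: "holo_near p f \<Longrightarrow> holo_near p g \<Longrightarrow> holo_near p (\<lambda>z. f z + g z)"
  by (erule (1) holo_near_common) (rule holo_nearI, assumption+, rule holo_on_add)

lemma holo_near_mult: "holo_near p f \<Longrightarrow> holo_near p g \<Longrightarrow> holo_near p (\<lambda>z. f z * g z)"
  by (erule (1) holo_near_common) (rule holo_nearI, assumption+, rule holo_on_mult)

lemma holo_near_minus: "holo_near p f \<Longrightarrow> holo_near p (\<lambda>z. - f z)"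
  using holo_near_mult[OF holo_near_const[of p "-1"]] by simp

lemma holo_near_sum: "(\<And>i. i \<in> A \<Longrightarrow> holo_near p (f i)) \<Longrightarrow> holo_near p (\<lambda>z. \<Sum>i\<in>A. f i z)"
  by (induction A rule: infinite_finite_induct) (simp_all add: holo_near_const holo_near_add)

lemma holo_near_pd: "holo_near p f \<Longrightarrow> holo_near p (pd i f)"
  unfolding holo_near_def using holo_on_pd by blast

lemma pd_cong:
  fixes f g :: "complex ^ 'n \<Rightarrow> complex"
  assumes "\<forall>\<^sub>F w in nhds z. f w = g w"
  shows "pd i f z = pd i g z"
proof -
  obtain W where W: "open W" "z \<in> W" "\<And>w. w \<in> W \<Longrightarrow> f w = g w"
    using assms unfolding eventually_nhds by blast
  have "open ((\<lambda>t. z + axis i t) -` W)"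
    by (intro open_vimage W(1) continuous_intros bounded_linear.continuous_on[OF bounded_linear_axis])
  moreover have "z + axis i 0 = z" by (simp add: vec_eq_iff axis_def)
  then have "0 \<in> (\<lambda>t. z + axis i t) -` W" using W(2) by (simp only: vimage_eq)
  ultimately have "\<forall>\<^sub>F t in nhds 0. f (z + axis i t) = g (z + axis i t)"
    unfolding eventually_nhds using W(3) by (intro exI[of _ "(\<lambda>t. z + axis i t) -` W"]) auto
  then show ?thesis unfolding pd_def by (rule deriv_cong_ev) simp
qed

lemma cring_holo_ring: "cring (holo_ring p)"
proof (rule cringI)
  show "abelian_group (holo_ring p)"
    by (rule abelian_groupI)
      (auto simp: holo_ring_def holo_near_const holo_near_add intro: exI[of _ "\<lambda>z. - f z" for f] holo_near_minus)
  show "comm_monoid (holo_ring p)"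
    by (rule comm_monoidI) (auto simp: holo_ring_def holo_near_const holo_near_mult)
qed (auto simp: holo_ring_def distrib_right)

lemma ideal_null_near: "ideal (null_near p) (holo_ring p)"
proof (rule cring.ideal_if_closed[OF cring_holo_ring])
  show "f \<oplus>\<^bsub>holo_ring p\<^esub> g \<in> null_near p" if "f \<in> null_near p" "g \<in> null_near p" for f g
  proof -
    have "\<forall>\<^sub>F z in nhds p. f z = 0" "\<forall>\<^sub>F z in nhds p. g z = 0"
      using that by (auto simp: null_near_def)
    then have "\<forall>\<^sub>F z in nhds p. f z + g z = 0" by eventually_elim simp
    then show ?thesis using that by (simp add: null_near_def holo_ring_def holo_near_add)
  qed
  show "a \<otimes>\<^bsub>holo_ring p\<^esub> f \<in> null_near p" if "a \<in> carrier (holo_ring p)" "f \<in> null_near p" for a f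
  proof -
    have "\<forall>\<^sub>F z in nhds p. f z = 0" using that by (auto simp: null_near_def)
    then have "\<forall>\<^sub>F z in nhds p. a z * f z = 0" by eventually_elim simp
    then show ?thesis using that by (simp add: null_near_def holo_ring_def holo_near_mult)
  qed
qed (auto simp: null_near_def holo_ring_def holo_near_const)

lemma cring_germ_ring: "cring (germ_ring p)"
  unfolding germ_ring_def by (rule ideal.quotient_is_cring[OF ideal_null_near cring_holo_ring])

lemma germ_hom: "ring_hom_cring (holo_ring p) (germ_ring p) (germ p)"
  using ideal.rcos_ring_hom_cring[OF ideal_null_near cring_holo_ring]
  unfolding germ_ring_def germ_def[abs_def] .

lemma germ_closed: "holo_near p f \<Longrightarrow> germ p f \<in> carrier (germ_ring p)"
  using ring_hom_closed[OF ring_hom_cring.homh[OF germ_hom]] by (simp add: holo_ring_def)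

lemma germ_add: "holo_near p f \<Longrightarrow> holo_near p g \<Longrightarrow>
    germ p f \<oplus>\<^bsub>germ_ring p\<^esub> germ p g = germ p (\<lambda>z. f z + g z)"
  using ring_hom_add[OF ring_hom_cring.homh[OF germ_hom], of f p g] by (simp add: holo_ring_def)

lemma germ_mult: "holo_near p f \<Longrightarrow> holo_near p g \<Longrightarrow>
    germ p f \<otimes>\<^bsub>germ_ring p\<^esub> germ p g = germ p (\<lambda>z. f z * g z)"
  using ring_hom_mult[OF ring_hom_cring.homh[OF germ_hom], of f p g] by (simp add: holo_ring_def)

lemma germ_one: "\<one>\<^bsub>germ_ring p\<^esub> = germ p (\<lambda>z. 1)"
  using ring_hom_one[OF ring_hom_cring.homh[OF germ_hom], of p] by (simp add: holo_ring_def)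

lemma germ_zero: "\<zero>\<^bsub>germ_ring p\<^esub> = germ p (\<lambda>z. 0)"
  using ring_hom_cring.hom_zero[OF germ_hom, of p] by (simp add: holo_ring_def)

lemma germ_sum:
  assumes "\<And>i. i \<in> A \<Longrightarrow> holo_near p (f i)" "finite A"
  shows "(\<Oplus>\<^bsub>germ_ring p\<^esub>i\<in>A. germ p (f i)) = germ p (\<lambda>z. \<Sum>i\<in>A. f i z)"
proof -
  interpret R: cring "germ_ring p" by (rule cring_germ_ring)
  show ?thesis
    using assms(2,1)
    by (induction A rule: finite_induct)
      (simp_all add: germ_zero germ_closed germ_add holo_near_sum Pi_iff)
qed

lemma germ_eq_set:
  assumes "holo_near p f"
  shows "germ p f = {g. holo_near p g \<and> (\<forall>\<^sub>F z in nhds p. g z = f z)}"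
proof (intro equalityI subsetI)
  fix g assume "g \<in> germ p f"
  then obtain n where n: "n \<in> null_near p" and g: "g = (\<lambda>z. n z + f z)"
    by (auto simp: germ_def a_r_coset_def' holo_ring_def)
  from n have "\<forall>\<^sub>F z in nhds p. n z = 0" by (simp add: null_near_def)
  then have "\<forall>\<^sub>F z in nhds p. g z = f z" by eventually_elim (simp add: g)
  then show "g \<in> {g. holo_near p g \<and> (\<forall>\<^sub>F z in nhds p. g z = f z)}"
    using n assms by (simp add: g null_near_def holo_near_add)
next
  fix g assume "g \<in> {g. holo_near p g \<and> (\<forall>\<^sub>F z in nhds p. g z = f z)}"
  then have g: "holo_near p g" "\<forall>\<^sub>F z in nhds p. g z = f z" by auto
  from g(2) have "\<forall>\<^sub>F z in nhds p. g z - f z = 0" by eventually_elim simp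
  moreover have "holo_near p (\<lambda>z. g z - f z)"
    using holo_near_add[OF g(1) holo_near_minus[OF assms]] by simp
  ultimately have "(\<lambda>z. g z - f z) \<in> null_near p" by (simp add: null_near_def)
  then show "g \<in> germ p f"
    by (auto simp: germ_def a_r_coset_def' holo_ring_def intro!: bexI[of _ "\<lambda>z. g z - f z"])
qed

lemma germ_eqI:
  assumes "holo_near p f" "holo_near p g" "\<forall>\<^sub>F z in nhds p. f z = g z"
  shows "germ p f = germ p g"
proof -
  have "(\<forall>\<^sub>F z in nhds p. h z = f z) \<longleftrightarrow> (\<forall>\<^sub>F z in nhds p. h z = g z)" for h
    by (rule eventually_subst) (use assms(3) in \<open>eventually_elim; simp\<close>)
  then show ?thesis by (simp add: germ_eq_set assms(1,2))
qed

lemma germ_eqD: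
  assumes "holo_near p f" "holo_near p g" "germ p f = germ p g"
  shows "\<forall>\<^sub>F z in nhds p. f z = g z"
proof -
  have "f \<in> germ p f" using assms(1) by (simp add: germ_eq_set)
  then show ?thesis using assms(2,3) by (simp add: germ_eq_set)
qed

lemma carrier_germ_ring: "carrier (germ_ring p) = {germ p f | f. holo_near p f}"
  by (auto simp: germ_ring_def FactRing_def A_RCOSETS_def' germ_def holo_ring_def)

text \<open>
  The representative that \<open>germ_pderiv\<close> picks agrees with \<open>f\<close> on a neighbourhood of \<open>p\<close>, hence so do
  the derivatives.
\<close>

lemma germ_pderiv_germ:
  assumes "holo_near p f"
  shows "germ_pderiv p i (germ p f) = germ p (pd i f)"
proof -
  define g where "g = (SOME g. g \<in> germ p f)"
  have "f \<in> germ p f" using assms by (simp add: germ_eq_set)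
  then have "g \<in> germ p f" unfolding g_def by (rule someI[of "\<lambda>g. g \<in> germ p f"])
  then have g: "holo_near p g" "\<forall>\<^sub>F z in nhds p. g z = f z"
    using assms by (simp_all add: germ_eq_set)
  from g(2) have "\<forall>\<^sub>F z in nhds p. \<forall>\<^sub>F w in nhds z. g w = f w"
    by (simp add: eventually_eventually)
  then have "\<forall>\<^sub>F z in nhds p. pd i g z = pd i f z"
    by eventually_elim (rule pd_cong)
  then have "germ p (pd i g) = germ p (pd i f)"
    using g(1) assms by (intro germ_eqI holo_near_pd)
  then show ?thesis by (simp add: germ_pderiv_def g_def pd_def[abs_def])
qed

lemma germ_in_vanishing_ideal:
  assumes "holo_near p f"
  shows "germ p f \<in> vanishing_ideal p X \<longleftrightarrow> (\<forall>\<^sub>F z in nhds p. z \<in> X \<longrightarrow> f z = 0)"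
proof
  assume "germ p f \<in> vanishing_ideal p X"
  then obtain g where g: "holo_near p g" "\<forall>\<^sub>F z in nhds p. z \<in> X \<longrightarrow> g z = 0" "germ p f = germ p g"
    by (auto simp: vanishing_ideal_def)
  have "\<forall>\<^sub>F z in nhds p. f z = g z" by (rule germ_eqD[OF assms g(1,3)])
  with g(2) show "\<forall>\<^sub>F z in nhds p. z \<in> X \<longrightarrow> f z = 0" by eventually_elim simp
qed (use assms in \<open>auto simp: vanishing_ideal_def\<close>)

lemma ideal_vanishing_ideal: "ideal (vanishing_ideal p X) (germ_ring p)"
proof (rule cring.ideal_if_closed[OF cring_germ_ring])
  show "vanishing_ideal p X \<subseteq> carrier (germ_ring p)"
    by (auto simp: vanishing_ideal_def germ_closed)
  show "\<zero>\<^bsub>germ_ring p\<^esub> \<in> vanishing_ideal p X"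
    by (simp add: germ_zero germ_in_vanishing_ideal holo_near_const)
  show "x \<oplus>\<^bsub>germ_ring p\<^esub> y \<in> vanishing_ideal p X"
    if xy: "x \<in> vanishing_ideal p X" "y \<in> vanishing_ideal p X" for x y
  proof -
    obtain f g where *: "x = germ p f" "y = germ p g" "holo_near p f" "holo_near p g"
      and "\<forall>\<^sub>F z in nhds p. z \<in> X \<longrightarrow> f z = 0" "\<forall>\<^sub>F z in nhds p. z \<in> X \<longrightarrow> g z = 0"
      using xy by (auto simp: vanishing_ideal_def)
    from this(5,6) have "\<forall>\<^sub>F z in nhds p. z \<in> X \<longrightarrow> f z + g z = 0" by eventually_elim simp
    then show ?thesis using * by (simp add: germ_add germ_in_vanishing_ideal holo_near_add)
  qed
  show "a \<otimes>\<^bsub>germ_ring p\<^esub> x \<in> vanishing_ideal p X"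
    if a: "a \<in> carrier (germ_ring p)" and x: "x \<in> vanishing_ideal p X" for a x
  proof -
    obtain f where f: "a = germ p f" "holo_near p f"
      using a by (auto simp: carrier_germ_ring)
    obtain g where g: "x = germ p g" "holo_near p g" "\<forall>\<^sub>F z in nhds p. z \<in> X \<longrightarrow> g z = 0"
      using x by (auto simp: vanishing_ideal_def)
    from g(3) have "\<forall>\<^sub>F z in nhds p. z \<in> X \<longrightarrow> f z * g z = 0" by eventually_elim simp
    then show ?thesis using f g(1,2) by (simp add: germ_mult germ_in_vanishing_ideal holo_near_mult)
  qed
qed

lemma abelian_monoid_der_module: "abelian_monoid (der_module p)"
proof -
  interpret R: cring "germ_ring p" by (rule cring_germ_ring)
  show ?thesis
    by (rule abelian_monoidI) (auto simp: der_module_def vec_eq_iff R.a_ac)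
qed

lemma finsum_der_module:
  assumes "finite A" "\<And>j i. j \<in> A \<Longrightarrow> v j $ i \<in> carrier (germ_ring p)"
  shows "(\<Oplus>\<^bsub>der_module p\<^esub>j\<in>A. v j) = (\<chi> i. \<Oplus>\<^bsub>germ_ring p\<^esub>j\<in>A. v j $ i)"
proof -
  interpret R: cring "germ_ring p" by (rule cring_germ_ring)
  interpret M: abelian_monoid "der_module p" by (rule abelian_monoid_der_module)
  have carrier: "w \<in> carrier (der_module p) \<longleftrightarrow> (\<forall>i. w $ i \<in> carrier (germ_ring p))" for w
    by (simp add: der_module_def)
  show ?thesis
    using assms
  proof (induction A rule: finite_induct)
    case (insert a A)
    then have "(\<Oplus>\<^bsub>der_module p\<^esub>j\<in>insert a A. v j) = v a \<oplus>\<^bsub>der_module p\<^esub> (\<Oplus>\<^bsub>der_module p\<^esub>j\<in>A. v j)"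
      by (intro M.finsum_insert) (auto simp: carrier)
    also have "(\<Oplus>\<^bsub>der_module p\<^esub>j\<in>A. v j) = (\<chi> i. \<Oplus>\<^bsub>germ_ring p\<^esub>j\<in>A. v j $ i)"
      using insert by auto
    finally show ?case
      using insert by (simp add: der_module_def vec_eq_iff Pi_iff)
  next
    case empty
    have "\<zero>\<^bsub>der_module p\<^esub> = (\<chi> i. \<zero>\<^bsub>germ_ring p\<^esub>)" by (simp add: der_module_def)
    then show ?case by (simp only: M.finsum_empty R.finsum_empty)
  qed
qed

lemma generates_der_module_iff:
  "generates (germ_ring p) (der_module p) m \<eta> L \<longleftrightarrow>
     (\<forall>j<m. \<forall>i. \<eta> j $ i \<in> carrier (germ_ring p)) \<and> L = lin_span (germ_ring p) m \<eta>"
proof -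
  interpret R: cring "germ_ring p" by (rule cring_germ_ring)
  have comb: "(\<Oplus>\<^bsub>der_module p\<^esub>j\<in>{..<m}. c j \<odot>\<^bsub>der_module p\<^esub> \<eta> j) =
      (\<chi> i. \<Oplus>\<^bsub>germ_ring p\<^esub>j\<in>{..<m}. c j \<otimes>\<^bsub>germ_ring p\<^esub> \<eta> j $ i)"
    if "\<forall>j<m. \<forall>i. \<eta> j $ i \<in> carrier (germ_ring p)" "\<forall>j<m. c j \<in> carrier (germ_ring p)" for c
  proof -
    have smult: "c j \<odot>\<^bsub>der_module p\<^esub> \<eta> j = (\<chi> i. c j \<otimes>\<^bsub>germ_ring p\<^esub> \<eta> j $ i)" for j
      by (simp add: der_module_def)
    show ?thesis
      unfolding smult using that by (subst finsum_der_module) simp_all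
  qed
  have "{(\<Oplus>\<^bsub>der_module p\<^esub>j\<in>{..<m}. c j \<odot>\<^bsub>der_module p\<^esub> \<eta> j) | c. \<forall>j<m. c j \<in> carrier (germ_ring p)} =
      lin_span (germ_ring p) m \<eta>" if "\<forall>j<m. \<forall>i. \<eta> j $ i \<in> carrier (germ_ring p)"
    unfolding lin_span_def by (intro Collect_cong ex_cong1 rev_conj_cong refl) (simp only: comb[OF that])
  then show ?thesis by (auto simp: generates_def der_module_def)
qed

text \<open>
  The description operator is resolved: every generating family yields the same ideal, and one exists
  by assumption.
\<close>

lemma I_minors_eq:
  assumes "\<exists>m \<eta>. (\<forall>j<m. \<forall>i. \<eta> j $ i \<in> carrier (germ_ring p)) \<and> L = lin_span (germ_ring p) m \<eta>"
  shows "I_minors p k L = Idl\<^bsub>germ_ring p\<^esub> (minors_of (germ_ring p) k L)"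
proof -
  have eq: "minors_ideal p k m \<eta> = Idl\<^bsub>germ_ring p\<^esub> (minors_of (germ_ring p) k L)"
    if "generates (germ_ring p) (der_module p) m \<eta> L" for m \<eta>
    using that cring.ideal_of_minors_generating_family[OF cring_germ_ring, of m \<eta> p k]
    by (simp add: generates_der_module_iff minors_ideal_def)
  show ?thesis
    unfolding I_minors_def
  proof (rule the_equality)
    show "\<exists>m \<eta>. generates (germ_ring p) (der_module p) m \<eta> L \<and>
        Idl\<^bsub>germ_ring p\<^esub> (minors_of (germ_ring p) k L) = minors_ideal p k m \<eta>"
      using assms eq unfolding generates_der_module_iff by metis
  qed (use eq in blast)
qed


section \<open>Logarithmic vector fields of a smooth germ\<close>

lemma jacobian_inverse:
  assumes "open U" "holo_map_on U \<phi>" "\<phi> ` U \<subseteq> V" "holo_map_on V \<psi>"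
    and inv: "\<And>z. z \<in> U \<Longrightarrow> \<psi> (\<phi> z) = z" and z: "z \<in> U"
  shows "(\<Sum>j\<in>UNIV. pd j (\<lambda>w. \<psi> w $ i) (\<phi> z) * pd l (\<lambda>z. \<phi> z $ j) z) = (if i = l then 1 else 0)"
proof -
  have "(\<Sum>j\<in>UNIV. pd j (\<lambda>w. \<psi> w $ i) (\<phi> z) * pd l (\<lambda>z. \<phi> z $ j) z) = pd l (\<lambda>z. \<psi> (\<phi> z) $ i) z"
    using assms(4) pd_compose[OF assms(2,3) _ z, of "\<lambda>w. \<psi> w $ i" l] by (simp add: holo_map_on_def)
  also have "\<dots> = pd l (\<lambda>z. z $ i) z"
    using assms(1) z inv by (intro pd_cong) (auto simp: eventually_nhds intro!: exI[of _ U])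
  also have "\<dots> = (if i = l then 1 else 0)"
  proof -
    have "pd l (\<lambda>z. z $ i) z = axis l 1 $ i"
      by (rule pd_eqI) (auto intro!: bounded_linear.has_derivative[OF bounded_linear_vec_nth])
    then show ?thesis by (simp add: axis_def)
  qed
  finally show ?thesis .
qed

text \<open>
  For \<open>i \<in> S\<close> the \<open>i\<close>-th coordinate line through a point of the subspace stays in it.
\<close>

lemma pd_eq_0_on_subspace:
  assumes "open W" "w \<in> W"
    and zero: "\<And>w. w \<in> W \<Longrightarrow> (\<And>i. i \<notin> S \<Longrightarrow> w $ i = 0) \<Longrightarrow> F w = 0"
    and w: "\<And>i. i \<notin> S \<Longrightarrow> w $ i = 0" and i: "i \<in> S"
  shows "pd i F (w :: complex ^ 'n) = 0"
proof -
  let ?N = "(\<lambda>t. w + axis i t) -` W"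
  have "open ?N"
    by (intro open_vimage assms(1) continuous_intros bounded_linear.continuous_on[OF bounded_linear_axis])
  moreover have "w + axis i 0 = w" by (simp add: vec_eq_iff axis_def)
  then have "0 \<in> ?N" using assms(2) by (simp only: vimage_eq)
  moreover have "F (w + axis i t) = 0" if "t \<in> ?N" for t
    using that w i by (intro zero) (auto simp: axis_def)
  ultimately have "\<forall>\<^sub>F t in nhds 0. F (w + axis i t) = 0"
    unfolding eventually_nhds by blast
  then have "pd i F w = deriv (\<lambda>t. 0) 0"
    unfolding pd_def by (rule deriv_cong_ev) simp
  then show ?thesis by simp
qed

lemma holo_map_on_imp_continuous_on:
  assumes "holo_map_on U \<phi>"
  shows "continuous_on U \<phi>"
proof -
  have "continuous_on U (\<lambda>z. \<chi> i. \<phi> z $ i)"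
    using assms by (intro continuous_on_vec_lambda holo_on_imp_continuous_on) (simp add: holo_map_on_def)
  then show ?thesis by simp
qed

text \<open>
  The data provided by \<open>smooth_analytic_germ\<close>.
\<close>

locale straightening =
  fixes X :: "(complex ^ 'n) set" and p :: "complex ^ 'n"
    and U V :: "(complex ^ 'n) set" and \<phi> \<psi> :: "complex ^ 'n \<Rightarrow> complex ^ 'n" and S :: "'n set"
  assumes U: "open U" "p \<in> U" and V: "open V"
    and p_in_X: "p \<in> X"
    and holo_phi: "holo_map_on U \<phi>" and holo_psi: "holo_map_on V \<psi>"
    and phi_U: "\<phi> ` U = V" and psi_V: "\<psi> ` V = U"
    and psi_phi: "\<And>z. z \<in> U \<Longrightarrow> \<psi> (\<phi> z) = z" and phi_psi: "\<And>w. w \<in> V \<Longrightarrow> \<phi> (\<psi> w) = w"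
    and phi_X: "\<phi> ` (X \<inter> U) = {w \<in> V. \<forall>i. i \<notin> S \<longrightarrow> w $ i = 0}"
begin

definition jac :: "'n \<Rightarrow> 'n \<Rightarrow> 'n germ" where
  "jac i j = germ p (pd j (\<lambda>z. \<phi> z $ i))"

definition jac_inv :: "'n \<Rightarrow> 'n \<Rightarrow> 'n germ" where
  "jac_inv i j = germ p (\<lambda>z. pd j (\<lambda>w. \<psi> w $ i) (\<phi> z))"

lemma holo_near_phi: "holo_near p (\<lambda>z. \<phi> z $ i)"
  using holo_phi U by (auto simp: holo_map_on_def intro: holo_nearI)

lemma open_preimage_phi:
  assumes "open W"
  shows "open (U \<inter> \<phi> -` W)"
proof -
  have "continuous_on U \<phi>" by (rule holo_map_on_imp_continuous_on[OF holo_phi])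
  then show ?thesis using U(1) assms by (rule continuous_open_preimage)
qed

lemma holo_map_on_preimage_phi: "holo_map_on (U \<inter> \<phi> -` W) \<phi>"
  using holo_phi by (auto simp: holo_map_on_def intro: holo_on_subset)

lemma eventually_phi_in:
  assumes "open W" "\<phi> p \<in> W"
  shows "\<forall>\<^sub>F z in nhds p. z \<in> U \<inter> \<phi> -` W"
  unfolding eventually_nhds
  using open_preimage_phi[OF assms(1)] assms(2) U(2) by (intro exI[of _ "U \<inter> \<phi> -` W"]) auto

lemma holo_near_comp_phi:
  assumes "open W" "\<phi> p \<in> W" "holo_on W g"
  shows "holo_near p (\<lambda>z. g (\<phi> z))"
proof (rule holo_nearI[OF open_preimage_phi[OF assms(1)]])
  show "holo_on (U \<inter> \<phi> -` W) (\<lambda>z. g (\<phi> z))"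
    using holo_map_on_preimage_phi _ assms(3) by (rule holo_on_compose) auto
qed (use assms(2) U(2) in auto)

lemma phi_p_in_V: "\<phi> p \<in> V"
  using phi_U U(2) by blast

lemma holo_near_jac_inv: "holo_near p (\<lambda>z. pd j (\<lambda>w. \<psi> w $ i) (\<phi> z))"
  using holo_psi V phi_p_in_V
  by (intro holo_near_comp_phi[of V] holo_on_pd) (auto simp: holo_map_on_def)

lemma jac_closed: "jac i j \<in> carrier (germ_ring p)"
  unfolding jac_def by (intro germ_closed holo_near_pd holo_near_phi)

lemma jac_inv_closed: "jac_inv i j \<in> carrier (germ_ring p)"
  unfolding jac_inv_def by (intro germ_closed holo_near_jac_inv)

lemma germ_kronecker:
  "germ p (\<lambda>z. if i = l then 1 else 0) = (if i = l then \<one>\<^bsub>germ_ring p\<^esub> else \<zero>\<^bsub>germ_ring p\<^esub>)"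
  by (simp add: germ_one germ_zero)

lemma eventually_in_U: "(\<And>z. z \<in> U \<Longrightarrow> P z) \<Longrightarrow> \<forall>\<^sub>F z in nhds p. P z"
  using U by (auto simp: eventually_nhds)

lemma jac_inv_jac:
  "(\<Oplus>\<^bsub>germ_ring p\<^esub>j\<in>UNIV. jac_inv i j \<otimes>\<^bsub>germ_ring p\<^esub> jac j l) =
    (if i = l then \<one>\<^bsub>germ_ring p\<^esub> else \<zero>\<^bsub>germ_ring p\<^esub>)"
proof -
  let ?f = "\<lambda>j z. pd j (\<lambda>w. \<psi> w $ i) (\<phi> z) * pd l (\<lambda>z. \<phi> z $ j) z"
  have holo: "holo_near p (?f j)" for j
    by (intro holo_near_mult holo_near_jac_inv holo_near_pd holo_near_phi)
  have "(\<Oplus>\<^bsub>germ_ring p\<^esub>j\<in>UNIV. jac_inv i j \<otimes>\<^bsub>germ_ring p\<^esub> jac j l) = (\<Oplus>\<^bsub>germ_ring p\<^esub>j\<in>UNIV. germ p (?f j))"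
    by (simp add: jac_def jac_inv_def germ_mult holo_near_jac_inv holo_near_pd holo_near_phi)
  also have "\<dots> = germ p (\<lambda>z. \<Sum>j\<in>UNIV. ?f j z)" by (rule germ_sum[OF holo]) simp
  also have "\<dots> = germ p (\<lambda>z. if i = l then 1 else 0)"
    by (intro germ_eqI holo_near_sum holo holo_near_const eventually_in_U
        jacobian_inverse[OF U(1) holo_phi eq_refl[OF phi_U] holo_psi psi_phi])
  finally show ?thesis by (simp only: germ_kronecker)
qed

lemma jac_jac_inv:
  "(\<Oplus>\<^bsub>germ_ring p\<^esub>j\<in>UNIV. jac i j \<otimes>\<^bsub>germ_ring p\<^esub> jac_inv j l) =
    (if i = l then \<one>\<^bsub>germ_ring p\<^esub> else \<zero>\<^bsub>germ_ring p\<^esub>)"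
proof -
  let ?f = "\<lambda>j z. pd j (\<lambda>z. \<phi> z $ i) z * pd l (\<lambda>w. \<psi> w $ j) (\<phi> z)"
  have holo: "holo_near p (?f j)" for j
    by (intro holo_near_mult holo_near_jac_inv holo_near_pd holo_near_phi)
  have "(\<Oplus>\<^bsub>germ_ring p\<^esub>j\<in>UNIV. jac i j \<otimes>\<^bsub>germ_ring p\<^esub> jac_inv j l) = (\<Oplus>\<^bsub>germ_ring p\<^esub>j\<in>UNIV. germ p (?f j))"
    by (simp add: jac_def jac_inv_def germ_mult holo_near_jac_inv holo_near_pd holo_near_phi)
  also have "\<dots> = germ p (\<lambda>z. \<Sum>j\<in>UNIV. ?f j z)" by (rule germ_sum[OF holo]) simp
  also have "\<dots> = germ p (\<lambda>z. if i = l then 1 else 0)"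
  proof (intro germ_eqI holo_near_sum holo holo_near_const eventually_in_U)
    fix z assume z: "z \<in> U"
    then have "\<phi> z \<in> V" using phi_U by blast
    from jacobian_inverse[OF V holo_psi eq_refl[OF psi_V] holo_phi phi_psi this, of i l]
    show "(\<Sum>j\<in>UNIV. ?f j z) = (if i = l then 1 else 0)"
      by (simp only: psi_phi[OF z])
  qed
  finally show ?thesis by (simp only: germ_kronecker)
qed

text \<open>
  In the straightening coordinates a representative of a germ in \<open>I(X)\<close> is a holomorphic function that
  vanishes on the coordinate subspace.
\<close>

lemma pullback:
  assumes "holo_near p f" "\<forall>\<^sub>F z in nhds p. z \<in> X \<longrightarrow> f z = 0"
  obtains W where "open W" "\<phi> p \<in> W" "W \<subseteq> V" "holo_on W (\<lambda>w. f (\<psi> w))"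
    and "\<And>w. w \<in> W \<Longrightarrow> (\<And>i. i \<notin> S \<Longrightarrow> w $ i = 0) \<Longrightarrow> f (\<psi> w) = 0"
proof -
  obtain N where N: "open N" "p \<in> N" "holo_on N f"
    using assms(1) unfolding holo_near_def by blast
  obtain N' where N': "open N'" "p \<in> N'" "\<And>z. z \<in> N' \<Longrightarrow> z \<in> X \<Longrightarrow> f z = 0"
    using assms(2) unfolding eventually_nhds by blast
  define W where "W = V \<inter> \<psi> -` (N \<inter> N')"
  have "continuous_on V \<psi>" by (rule holo_map_on_imp_continuous_on[OF holo_psi])
  then have "open W"
    unfolding W_def using V open_Int[OF N(1) N'(1)] by (rule continuous_open_preimage)
  moreover have "\<phi> p \<in> W"
    using phi_p_in_V N(2) N'(2) U(2) by (simp add: W_def psi_phi)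
  moreover have "holo_on W (\<lambda>w. f (\<psi> w))"
  proof (rule holo_on_compose)
    show "holo_map_on W \<psi>"
      using holo_psi by (auto simp: holo_map_on_def W_def intro: holo_on_subset)
  qed (use N(3) in \<open>auto simp: W_def\<close>)
  moreover have "f (\<psi> w) = 0" if w: "w \<in> W" and zero: "\<And>i. i \<notin> S \<Longrightarrow> w $ i = 0" for w
  proof -
    have "w \<in> \<phi> ` (X \<inter> U)" using w zero by (auto simp: phi_X W_def)
    then have "\<psi> w \<in> X" using psi_phi by auto
    then show ?thesis using w N'(3) by (simp add: W_def)
  qed
  ultimately show ?thesis by (intro that[of W]) (auto simp: W_def)
qed

lemma phi_X_zero: "z \<in> X \<Longrightarrow> z \<in> U \<Longrightarrow> i \<notin> S \<Longrightarrow> \<phi> z $ i = 0"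
  using phi_X by blast

lemma germ_phi_in_vanishing_ideal: "i \<notin> S \<Longrightarrow> germ p (\<lambda>z. \<phi> z $ i) \<in> vanishing_ideal p X"
  by (simp add: germ_in_vanishing_ideal holo_near_phi) (rule eventually_in_U, simp add: phi_X_zero)

text \<open>
  One inclusion tests \<open>\<eta>\<close> on the germs \<open>\<phi>\<^sub>i\<close>, \<open>i \<notin> S\<close>. For the other, \<open>\<eta>(f)\<close> is the sum over \<open>i\<close> of
  \<open>\<partial>\<^sub>i (f \<circ> \<psi>)\<close> at \<open>\<phi>\<close> times \<open>(J \<eta>)\<^sub>i\<close>; the first factor lies in \<open>I(X)\<close> for \<open>i \<in> S\<close>, the second
  one for \<open>i \<notin> S\<close>.
\<close>

lemma der_log_eq: "der_log p X = log_submodule (germ_ring p) jac S (vanishing_ideal p X)"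
proof (intro equalityI subsetI)
  interpret R: cring "germ_ring p" by (rule cring_germ_ring)
  fix \<eta> assume "\<eta> \<in> der_log p X"
  then have \<eta>: "\<And>i. \<eta> $ i \<in> carrier (germ_ring p)"
    and log: "\<And>G. G \<in> vanishing_ideal p X \<Longrightarrow> der_apply p \<eta> G \<in> vanishing_ideal p X"
    by (auto simp: der_log_def der_module_def)
  have "mat_vec (germ_ring p) jac \<eta> $ i = der_apply p \<eta> (germ p (\<lambda>z. \<phi> z $ i))" for i
    unfolding mat_vec_def der_apply_def vec_lambda_beta
    using \<eta> jac_closed[of i]
    by (intro R.finsum_cong') (auto simp: germ_pderiv_germ holo_near_phi R.m_comm jac_def)
  then show "\<eta> \<in> log_submodule (germ_ring p) jac S (vanishing_ideal p X)"
    using \<eta> log[OF germ_phi_in_vanishing_ideal] by (simp add: log_submodule_def)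
next
  interpret R: cring "germ_ring p" by (rule cring_germ_ring)
  interpret I: ideal "vanishing_ideal p X" "germ_ring p" by (rule ideal_vanishing_ideal)
  fix \<eta> assume "\<eta> \<in> log_submodule (germ_ring p) jac S (vanishing_ideal p X)"
  then have \<eta>: "\<And>i. \<eta> $ i \<in> carrier (germ_ring p)"
    and log: "\<And>i. i \<notin> S \<Longrightarrow> mat_vec (germ_ring p) jac \<eta> $ i \<in> vanishing_ideal p X"
    by (auto simp: log_submodule_def)
  have "der_apply p \<eta> G \<in> vanishing_ideal p X" if "G \<in> vanishing_ideal p X" for G
  proof -
    obtain f where G: "G = germ p f" and f: "holo_near p f" "\<forall>\<^sub>F z in nhds p. z \<in> X \<longrightarrow> f z = 0"
      using \<open>G \<in> vanishing_ideal p X\<close> by (auto simp: vanishing_ideal_def)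
    obtain W where W: "open W" "\<phi> p \<in> W" "W \<subseteq> V" and F: "holo_on W (\<lambda>w. f (\<psi> w))"
      and zero: "\<And>w. w \<in> W \<Longrightarrow> (\<And>i. i \<notin> S \<Longrightarrow> w $ i = 0) \<Longrightarrow> f (\<psi> w) = 0"
      using pullback[OF f] by blast
    define h where "h i z = pd i (\<lambda>w. f (\<psi> w)) (\<phi> z)" for i z
    have holo_h: "holo_near p (h i)" for i
      unfolding h_def using W(1) F by (intro holo_near_comp_phi[OF W(1,2)] holo_on_pd)
    have h: "germ p (h i) \<in> carrier (germ_ring p)" for i by (intro germ_closed holo_h)
    have pd_f: "germ p (pd j f) = (\<Oplus>\<^bsub>germ_ring p\<^esub>i\<in>UNIV. germ p (h i) \<otimes>\<^bsub>germ_ring p\<^esub> jac i j)" for j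
    proof -
      let ?f = "\<lambda>i z. h i z * pd j (\<lambda>z. \<phi> z $ i) z"
      have holo: "holo_near p (?f i)" for i
        by (intro holo_near_mult holo_h holo_near_pd holo_near_phi)
      have "pd j f z = (\<Sum>i\<in>UNIV. ?f i z)" if z: "z \<in> U \<inter> \<phi> -` W" for z
      proof -
        have "pd j f z = pd j (\<lambda>z. f (\<psi> (\<phi> z))) z"
          using z U(1) psi_phi by (intro pd_cong) (auto simp: eventually_nhds intro!: exI[of _ U])
        also have "\<dots> = (\<Sum>i\<in>UNIV. ?f i z)"
          unfolding h_def by (rule pd_compose[OF holo_map_on_preimage_phi _ F z]) auto
        finally show ?thesis .
      qed
      then have "\<forall>\<^sub>F z in nhds p. pd j f z = (\<Sum>i\<in>UNIV. ?f i z)"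
        by (rule eventually_mono[OF eventually_phi_in[OF W(1,2)]])
      then have "germ p (pd j f) = germ p (\<lambda>z. \<Sum>i\<in>UNIV. ?f i z)"
        by (intro germ_eqI holo_near_pd f(1) holo_near_sum holo)
      also have "\<dots> = (\<Oplus>\<^bsub>germ_ring p\<^esub>i\<in>UNIV. germ p (?f i))"
        by (rule germ_sum[symmetric, OF holo]) simp
      finally show ?thesis
        by (simp add: jac_def germ_mult holo_h holo_near_pd holo_near_phi)
    qed
    have "der_apply p \<eta> G = (\<Oplus>\<^bsub>germ_ring p\<^esub>j\<in>UNIV. \<Oplus>\<^bsub>germ_ring p\<^esub>i\<in>UNIV.
        germ p (h i) \<otimes>\<^bsub>germ_ring p\<^esub> (jac i j \<otimes>\<^bsub>germ_ring p\<^esub> \<eta> $ j))"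
      unfolding der_apply_def G germ_pderiv_germ[OF f(1)] pd_f
      using \<eta> h jac_closed
      by (intro R.finsum_cong' refl) (auto simp: R.finsum_rdistr R.m_ac intro!: R.finsum_closed)
    also have "\<dots> = (\<Oplus>\<^bsub>germ_ring p\<^esub>i\<in>UNIV. \<Oplus>\<^bsub>germ_ring p\<^esub>j\<in>UNIV.
        germ p (h i) \<otimes>\<^bsub>germ_ring p\<^esub> (jac i j \<otimes>\<^bsub>germ_ring p\<^esub> \<eta> $ j))"
      using \<eta> h jac_closed by (intro R.finsum_swap) auto
    also have "\<dots> = (\<Oplus>\<^bsub>germ_ring p\<^esub>i\<in>UNIV. germ p (h i) \<otimes>\<^bsub>germ_ring p\<^esub> mat_vec (germ_ring p) jac \<eta> $ i)"
      unfolding mat_vec_def vec_lambda_beta using \<eta> h jac_closed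
      by (intro R.finsum_cong' refl) (auto simp: R.finsum_rdistr intro!: R.finsum_closed)
    also have "\<dots> \<in> vanishing_ideal p X"
    proof (rule R.ideal_finsum_closed[OF ideal_vanishing_ideal])
      fix i
      have mv: "mat_vec (germ_ring p) jac \<eta> $ i \<in> carrier (germ_ring p)"
        using jac_closed \<eta> by (rule R.mat_vec_closed)
      show "germ p (h i) \<otimes>\<^bsub>germ_ring p\<^esub> mat_vec (germ_ring p) jac \<eta> $ i \<in> vanishing_ideal p X"
      proof (cases "i \<in> S")
        case True
        have "h i z = 0" if "z \<in> U \<inter> \<phi> -` W" "z \<in> X" for z
          unfolding h_def using that True phi_X_zero
          by (intro pd_eq_0_on_subspace[OF W(1) _ zero]) auto
        then have "\<forall>\<^sub>F z in nhds p. z \<in> X \<longrightarrow> h i z = 0"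
          by (intro eventually_mono[OF eventually_phi_in[OF W(1,2)]]) blast
        then have "germ p (h i) \<in> vanishing_ideal p X"
          by (simp add: germ_in_vanishing_ideal holo_h)
        then show ?thesis using mv by (rule I.I_r_closed)
      next
        case False
        then show ?thesis using log h by (intro I.I_l_closed)
      qed
    qed
    finally show ?thesis .
  qed
  then show "\<eta> \<in> der_log p X" using \<eta> by (simp add: der_log_def der_module_def)
qed

text \<open>
  The value \<open>0\<close> for \<open>j \<in> S\<close> allows sums over all indices.
\<close>

definition defining_germ :: "'n \<Rightarrow> 'n germ" where
  "defining_germ j = (if j \<in> S then \<zero>\<^bsub>germ_ring p\<^esub> else germ p (\<lambda>z. \<phi> z $ j))"

lemma defining_germ_in_vanishing_ideal: "defining_germ j \<in> vanishing_ideal p X"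
  using additive_subgroup.zero_closed[OF ideal.axioms(1)[OF ideal_vanishing_ideal[of p X]]]
  by (simp add: defining_germ_def germ_phi_in_vanishing_ideal)

text \<open>
  Hadamard's lemma in the straightening coordinates, pulled back by \<open>\<phi>\<close>.
\<close>

lemma vanishing_ideal_generated:
  assumes "x \<in> vanishing_ideal p X"
  shows "\<exists>b. (\<forall>j. b j \<in> carrier (germ_ring p)) \<and>
    x = (\<Oplus>\<^bsub>germ_ring p\<^esub>j\<in>UNIV. b j \<otimes>\<^bsub>germ_ring p\<^esub> defining_germ j)"
proof -
  interpret R: cring "germ_ring p" by (rule cring_germ_ring)
  obtain f where x: "x = germ p f" and f: "holo_near p f" "\<forall>\<^sub>F z in nhds p. z \<in> X \<longrightarrow> f z = 0"
    using assms by (auto simp: vanishing_ideal_def)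
  obtain W where W: "open W" "\<phi> p \<in> W" "W \<subseteq> V" and F: "holo_on W (\<lambda>w. f (\<psi> w))"
    and zero: "\<And>w. w \<in> W \<Longrightarrow> (\<And>i. i \<notin> S \<Longrightarrow> w $ i = 0) \<Longrightarrow> f (\<psi> w) = 0"
    using pullback[OF f] by blast
  obtain r where r: "r > 0" "ball (\<phi> p) r \<subseteq> W"
    using W(1,2) by (meson open_contains_ball)
  have "\<exists>g. (\<forall>i. holo_on (ball (\<phi> p) r) (g i)) \<and>
      (\<forall>w\<in>ball (\<phi> p) r. f (\<psi> w) = (\<Sum>i\<in>- S. w $ i * g i w))"
    using r(2) zero phi_X_zero[OF p_in_X U(2)]
    by (intro hadamard_division holo_on_subset[OF F]) auto
  then obtain g where g: "\<And>i. holo_on (ball (\<phi> p) r) (g i)"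
    and fg: "\<And>w. w \<in> ball (\<phi> p) r \<Longrightarrow> f (\<psi> w) = (\<Sum>i\<in>- S. w $ i * g i w)"
    by blast
  have centre: "\<phi> p \<in> ball (\<phi> p) r" using r(1) by simp
  define b where "b j z = g j (\<phi> z)" for j z
  have b: "holo_near p (b j)" for j
    unfolding b_def by (rule holo_near_comp_phi[OF open_ball centre g])
  let ?f = "\<lambda>j z. if j \<in> S then 0 else b j z * \<phi> z $ j"
  have holo: "holo_near p (?f j)" for j
    using b by (cases "j \<in> S") (simp_all add: holo_near_const holo_near_mult holo_near_phi)
  have "f z = (\<Sum>j\<in>UNIV. ?f j z)" if z: "z \<in> U \<inter> \<phi> -` ball (\<phi> p) r" for z
  proof -
    have "f z = (\<Sum>i\<in>- S. \<phi> z $ i * g i (\<phi> z))"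
      using fg[of "\<phi> z"] z by (simp add: psi_phi)
    also have "\<dots> = (\<Sum>j\<in>UNIV. ?f j z)"
      by (rule sum.mono_neutral_cong_left) (auto simp: b_def)
    finally show ?thesis .
  qed
  then have "\<forall>\<^sub>F z in nhds p. f z = (\<Sum>j\<in>UNIV. ?f j z)"
    by (rule eventually_mono[OF eventually_phi_in[OF open_ball centre]])
  then have "x = germ p (\<lambda>z. \<Sum>j\<in>UNIV. ?f j z)"
    unfolding x by (intro germ_eqI f(1) holo_near_sum holo)
  also have "\<dots> = (\<Oplus>\<^bsub>germ_ring p\<^esub>j\<in>UNIV. germ p (?f j))"
    by (rule germ_sum[symmetric, OF holo]) simp
  also have "\<dots> = (\<Oplus>\<^bsub>germ_ring p\<^esub>j\<in>UNIV. germ p (b j) \<otimes>\<^bsub>germ_ring p\<^esub> defining_germ j)"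
  proof -
    have "germ p (?f j) = germ p (b j) \<otimes>\<^bsub>germ_ring p\<^esub> defining_germ j" for j
      using germ_closed[OF b]
      by (cases "j \<in> S") (simp_all add: defining_germ_def germ_mult holo_near_phi b flip: germ_zero)
    then show ?thesis by (simp only:)
  qed
  finally show ?thesis
    by (intro exI[of _ "\<lambda>j. germ p (b j)"] conjI allI germ_closed b)
qed

lemma I_minors_der_log:
  assumes "k \<le> CARD('n)"
  shows "I_minors p k (der_log p X) = vanishing_ideal p X [^]\<^bsub>ideals_set (germ_ring p)\<^esub> (k - card S)"
proof -
  interpret R: cring "germ_ring p" by (rule cring_germ_ring)
  have "I_minors p k (der_log p X) =
      Idl\<^bsub>germ_ring p\<^esub> (minors_of (germ_ring p) k (log_submodule (germ_ring p) jac S (vanishing_ideal p X)))"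
    unfolding der_log_eq
    by (intro I_minors_eq R.log_submodule_finitely_generated[OF ideal_vanishing_ideal jac_closed jac_inv_closed
          jac_jac_inv jac_inv_jac defining_germ_in_vanishing_ideal vanishing_ideal_generated])
  also have "\<dots> = vanishing_ideal p X [^]\<^bsub>ideals_set (germ_ring p)\<^esub> (k - card S)"
    by (intro R.ideal_of_minors_log_submodule[OF ideal_vanishing_ideal jac_closed jac_inv_closed
          jac_jac_inv jac_inv_jac assms])
  finally show ?thesis .
qed

end

theorem proposition2p7:
  fixes X :: "(complex ^ 'n) set" and p :: "complex ^ 'n" and d k :: nat
  assumes "smooth_analytic_germ X p d"
    and "d < CARD('n)"
    and "1 \<le> k" and "k \<le> CARD('n)"
  shows "I_minors p k (der_log p X) =
           (if k > d then vanishing_ideal p X [^]\<^bsub>ideals_set (germ_ring p)\<^esub> (k - d)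
            else PIdl\<^bsub>germ_ring p\<^esub> \<one>\<^bsub>germ_ring p\<^esub>)"
proof -
  interpret R: cring "germ_ring p" by (rule cring_germ_ring)
  obtain U V \<phi> \<psi> S where S: "card S = d" and "straightening X p U V \<phi> \<psi> S"
    using assms(1) unfolding smooth_analytic_germ_def straightening_def by blast
  then interpret straightening X p U V \<phi> \<psi> S by simp
  have "PIdl\<^bsub>germ_ring p\<^esub> \<one>\<^bsub>germ_ring p\<^esub> = carrier (germ_ring p)"
    using R.cgenideal_eq_genideal[OF R.one_closed] R.genideal_one by simp
  then show ?thesis
    using I_minors_der_log[OF assms(4)] S by simp
qed

end
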